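(* Let $f_{m,n}=\mathbf{i}\,\frac nN+\mathbf{j}\,e^{\frac{2\pi\mathbf{i}}{M}m}$ be the discrete circular cylinder, where $M\in\mathbb{N}$, $M>2$, $N\in\mathbb{Z}$, with cross-ratios factorising function $\mu$ given by $\frac1{\mu_{(m,n),(m+1,n)}}=|1-e^{\frac{2\pi\mathbf{i}}{M}}|^2$ and $\frac1{\mu_{(m,n),(m,n+1)}}=-\frac1{N^2}$. Let $\rho,k\in\mathbb{N}$ and suppose that the spectral parameter $$\nu=\frac14\Bigl(1-\cot^2\frac{\pi}{M}\,\tan^2\frac{k\pi}{\rho M}\Bigr)$$ satisfies $\nu<0$. Consider the Darboux transforms $\hat f$ of $f$ with spectral parameter $\nu$, which are discrete isothermic cylinders with period $\rho M$ in the $m$-direction, and assume that $\hat f_{m,0}$ lives in the same $\mathbf{j}\mathbf{k}$-plane as $f_{m,0}=\mathbf{j}e^{\frac{2\pi\mathbf{i}}{M}m}$. Then, without loss of generality, the constants $c^\pm\in\mathbb{H}$ determining $\hat f$ (see the context) may be set to $c^+=\mathbf{j}$, $c^-=\mathbf{j}c_2$ for some $c_2\in\mathbb{C}$, and $\hat f$ has the closed-form parametrisation $$\hat f_{m,n}=f_{m,n}+\frac1{C_{m,n}}\bigl(T^0_{m,n}+\mathbf{j}\,T^1_{m,n}\bigr),$$ where $$\begin{aligned} A_m&=e^{\frac{k\pi\mathbf{i}}{\rho M}m}+e^{-\frac{k\pi\mathbf{i}}{\rho M}m}c_2,\\ B_m&=e^{\frac{k\pi\mathbf{i}}{\rho M}m}\sin\tfrac{(\rho+k)\pi}{\rho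 M}+e^{-\frac{k\pi\mathbf{i}}{\rho M}m}\sin\tfrac{(\rho-k)\pi}{\rho M}\,c_2,\\ C_{m,n}&=2\bigl((N-\sqrt{-\nu})^n+(N+\sqrt{-\nu})^n\bigr)^2|B_m|^2\\&\quad+\bigl((N-\sqrt{-\nu})^n-(N+\sqrt{-\nu})^n\bigr)^2|A_m|^2\bigl(\cos\tfrac{2\pi}{M}-\cos\tfrac{2k\pi}{\rho M}\bigr),\\ T^0_{m,n}&=\frac{\mathbf{i}}{\sqrt{-\nu}}\bigl((N-\sqrt{-\nu})^{2n}-(N+\sqrt{-\nu})^{2n}\bigr)\bigl(2|B_m|^2+|A_m|^2(\cos\tfrac{2\pi}{M}-\cos\tfrac{2k\pi}{\rho M})\bigr),\\ T^1_{m,n}&=-16\,e^{\frac{2\pi\mathbf{i}}{M}m}(N-\sqrt{-\nu})^n(N+\sqrt{-\nu})^n\sin\tfrac{\pi}{M}\cos\tfrac{k\pi}{\rho M}\,A_m\overline{B_m}. \end{aligned}$$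
   Context: $\mathbb{H}$ denotes the quaternions with basis $1,\mathbf{i},\mathbf{j},\mathbf{k}$; $\mathbb{C}=\mathrm{span}_{\mathbb{R}}\{1,\mathbf{i}\}$; $\mathbb{R}^3\cong\mathrm{Im}\,\mathbb{H}$. Vertices of an elementary quadrilateral in $\mathbb{Z}^2$: $i=(m,n)$, $j=(m+1,n)$, $k=(m+1,n+1)$, $\ell=(m,n+1)$. The cross-ratio is $\mathrm{cr}(a,b,c,d)=(a-b)(b-c)^{-1}(c-d)(d-a)^{-1}$. A discrete surface $f$ is discrete isothermic with cross-ratios factorising function $\mu$ (a real function on unoriented edges with $\mu_{ij}=\mu_{k\ell}$, $\mu_{i\ell}=\mu_{jk}$) if $\mathrm{cr}(f_i,f_j,f_k,f_\ell)=\mu_{i\ell}/\mu_{ij}$ on every elementary quadrilateral. A Darboux transform of $f$ with spectral parameter $\nu\in\mathbb{R}$ is a discrete surface $\hat f$ with $\mathrm{cr}(f_i,f_j,\hat f_j,\hat f_i)=\nu/\mu_{ij}$ on every edge $(ij)$. Such a Darboux transform is written $\hat f=f+ab^{-1}$, where $a,b$ are $\mathbb{H}$-valued functions on the vertices satisfying, on every edge $(ij)$, the linearised Riccati equation $a_i-a_j=-(f_i-f_j)b_i$, $b_i-b_j=-\frac{\nu}{\mu_{ij}}(f_i-f_j)^{-1}a_i$. Along the discrete circle $n=0$ one has, for constants $c^\pm\in\mathbb{H}$, $$a_{m,0}=\bigl(e^{-\frac{\pi\mathbf{i}}{M}}\cos\tfrac{\pi}{M}\sec\tfrac{k\pi}{\rho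 M}\bigr)^m\bigl(e^{-\frac{k\pi\mathbf{i}}{\rho M}m}c^++e^{\frac{k\pi\mathbf{i}}{\rho M}m}c^-\bigr),$$ and these constants determine $\hat f$.
   Formalization: If c⁺=0 the normalisation c⁺=j is impossible; that transform is given by the same formulas with k replaced by −k and c₂=0. If N²=−ν, where (N∓√−ν)ⁿ is undefined for n<0, the closed form and f̂=f+ab⁻¹ are claimed only for n≥0. N≠0 is assumed. *)

theory Defs
  imports Complex_Main
begin

datatype quat = Quat (qre: real) (qi: real) (qj: real) (qk: real)

lemma quat_eq_iff: "x = y \<longleftrightarrow> qre x = qre y \<and> qi x = qi y \<and> qj x = qj y \<and> qk x = qk y"
  by (cases x; cases y) auto

instantiation quat :: ab_group_add
begin

definition "0 = Quat 0 0 0 0"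
definition "x + y = Quat (qre x + qre y) (qi x + qi y) (qj x + qj y) (qk x + qk y)"
definition "- x = Quat (- qre x) (- qi x) (- qj x) (- qk x)"
definition "x - y = Quat (qre x - qre y) (qi x - qi y) (qj x - qj y) (qk x - qk y)"

instance
  by standard (simp_all add: zero_quat_def plus_quat_def uminus_quat_def minus_quat_def)

end

instantiation quat :: real_vector
begin

definition "r *\<^sub>R x = Quat (r * qre x) (r * qi x) (r * qj x) (r * qk x)"

instance
  by standard (simp_all add: scaleR_quat_def plus_quat_def quat_eq_iff algebra_simps)

end

instantiation quat :: real_algebra_1
begin

definition "1 = Quat 1 0 0 0"

definition "x * y = Quat
   (qre x * qre y - qi x * qi y - qj x * qj y - qk x * qk y)
   (qre x * qi y + qi x * qre y + qj x * qk y - qk x * qj y)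
   (qre x * qj y - qi x * qk y + qj x * qre y + qk x * qi y)
   (qre x * qk y + qi x * qj y - qj x * qi y + qk x * qre y)"

instance
  by standard
    (simp_all add: one_quat_def times_quat_def zero_quat_def plus_quat_def scaleR_quat_def
      quat_eq_iff algebra_simps)

end

instantiation quat :: real_div_algebra
begin

definition "inverse x =
  (let s = (qre x)\<^sup>2 + (qi x)\<^sup>2 + (qj x)\<^sup>2 + (qk x)\<^sup>2
   in Quat (qre x / s) (- qi x / s) (- qj x / s) (- qk x / s))"

definition "x div (y::quat) = x * inverse y"

instance
proof
  fix x y :: quat
  show "inverse (0::quat) = 0"
    by (simp add: inverse_quat_def zero_quat_def)
  show "x div y = x * inverse y"
    by (fact divide_quat_def)
  assume "x \<noteq> 0"
  define s where "s = (qre x)\<^sup>2 + (qi x)\<^sup>2 + (qj x)\<^sup>2 + (qk x)\<^sup>2"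
  have "s \<noteq> 0"
    using \<open>x \<noteq> 0\<close> unfolding s_def
    by (smt (verit) quat_eq_iff zero_quat_def quat.sel zero_le_power2 power_eq_0_iff)
  then have "qre x * qre x / s + qi x * qi x / s + qj x * qj x / s + qk x * qk x / s = 1"
    by (simp add: s_def power2_eq_square flip: add_divide_distrib)
  then show "inverse x * x = 1" "x * inverse x = 1"
    by (simp_all add: inverse_quat_def one_quat_def times_quat_def Let_def flip: s_def)
qed

end

definition quat_J :: quat where "quat_J = Quat 0 0 1 0"
definition quat_K :: quat where "quat_K = Quat 0 0 0 1"

definition quat_of_complex :: "complex \<Rightarrow> quat" where
  "quat_of_complex z = Quat (Re z) (Im z) 0 0"

type_synonym vertex = "int \<times> int"

text \<open>Edges are listed in the direction of increasing coordinates; this matters for the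
  linearised Riccati equation, which is not invariant under reversing an edge.\<close>

definition edge :: "vertex \<Rightarrow> vertex \<Rightarrow> bool" where
  "edge v w \<longleftrightarrow> w = (fst v + 1, snd v) \<or> w = (fst v, snd v + 1)"

definition quadrilateral :: "vertex \<Rightarrow> vertex \<Rightarrow> vertex \<Rightarrow> vertex \<Rightarrow> bool" where
  "quadrilateral i j k l \<longleftrightarrow>
     (\<exists>m n. i = (m, n) \<and> j = (m + 1, n) \<and> k = (m + 1, n + 1) \<and> l = (m, n + 1))"

definition cross_ratio :: "quat \<Rightarrow> quat \<Rightarrow> quat \<Rightarrow> quat \<Rightarrow> quat" where
  "cross_ratio a b c d = (a - b) * inverse (b - c) * (c - d) * inverse (d - a)"

text \<open>A function on unoriented edges is a symmetric function of the two end points.\<close>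

definition factorising_function :: "(vertex \<Rightarrow> vertex \<Rightarrow> real) \<Rightarrow> bool" where
  "factorising_function \<mu> \<longleftrightarrow>
     (\<forall>v w. edge v w \<longrightarrow> \<mu> v w = \<mu> w v) \<and>
     (\<forall>i j k l. quadrilateral i j k l \<longrightarrow> \<mu> i j = \<mu> k l \<and> \<mu> i l = \<mu> j k)"

definition discrete_isothermic :: "(vertex \<Rightarrow> quat) \<Rightarrow> (vertex \<Rightarrow> vertex \<Rightarrow> real) \<Rightarrow> bool" where
  "discrete_isothermic f \<mu> \<longleftrightarrow> factorising_function \<mu> \<and>
     (\<forall>i j k l. quadrilateral i j k l \<longrightarrow>
        cross_ratio (f i) (f j) (f k) (f l) = of_real (\<mu> i l / \<mu> i j))"

text \<open>Since \<open>inverse 0 = 0\<close>, a nonzero value of the cross-ratio forces neighbouring arguments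
  to be distinct, so no degenerate configurations are admitted when \<open>\<nu> \<noteq> 0\<close>.\<close>

definition darboux_transform ::
    "(vertex \<Rightarrow> quat) \<Rightarrow> (vertex \<Rightarrow> vertex \<Rightarrow> real) \<Rightarrow> real \<Rightarrow> (vertex \<Rightarrow> quat) \<Rightarrow> bool" where
  "darboux_transform f \<mu> \<nu> fh \<longleftrightarrow>
     (\<forall>i j. edge i j \<longrightarrow> cross_ratio (f i) (f j) (fh j) (fh i) = of_real (\<nu> / \<mu> i j))"

definition linearised_riccati_on ::
    "vertex set \<Rightarrow> (vertex \<Rightarrow> quat) \<Rightarrow> (vertex \<Rightarrow> vertex \<Rightarrow> real) \<Rightarrow> real \<Rightarrow>
     (vertex \<Rightarrow> quat) \<Rightarrow> (vertex \<Rightarrow> quat) \<Rightarrow> bool" where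
  "linearised_riccati_on D f \<mu> \<nu> a b \<longleftrightarrow>
     (\<forall>i\<in>D. \<forall>j\<in>D. edge i j \<longrightarrow>
        a i - a j = - (f i - f j) * b i \<and>
        b i - b j = - of_real (\<nu> / \<mu> i j) * inverse (f i - f j) * a i)"

definition cylinder :: "nat \<Rightarrow> int \<Rightarrow> vertex \<Rightarrow> quat" where
  "cylinder M N = (\<lambda>(m, n).
     quat_of_complex (\<i> * of_real (of_int n / of_int N))
     + quat_J * quat_of_complex (cis (2 * pi / M * m)))"

definition cylinder_mu :: "nat \<Rightarrow> int \<Rightarrow> vertex \<Rightarrow> vertex \<Rightarrow> real" where
  "cylinder_mu M N v w =
     (if snd v = snd w then 1 / (cmod (1 - cis (2 * pi / M)))\<^sup>2
      else 1 / (- 1 / (of_int N)\<^sup>2))"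

text \<open>In the definitions below \<open>k\<close> is an integer rather than a natural number because the
  exchange of \<open>c\<^sup>+\<close> and \<open>c\<^sup>-\<close> amounts to the replacement of \<open>k\<close> by \<open>- k\<close>.
  The transforms with \<open>c\<^sup>+ = 0\<close>, which cannot be normalised to \<open>c\<^sup>+ = j\<close> for \<open>k\<close> itself,
  are normalised for \<open>- k\<close>, with \<open>c\<^sub>2 = 0\<close>. Note that \<open>\<nu>\<close> is even in \<open>k\<close>.\<close>

definition theta :: "nat \<Rightarrow> nat \<Rightarrow> int \<Rightarrow> real" where
  "theta M \<rho> k = k * pi / (\<rho> * M)"

definition spectral_parameter :: "nat \<Rightarrow> nat \<Rightarrow> int \<Rightarrow> real" where
  "spectral_parameter M \<rho> k = 1 / 4 * (1 - (cot (pi / M))\<^sup>2 * (tan (theta M \<rho> k))\<^sup>2)"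

definition initial_a :: "nat \<Rightarrow> nat \<Rightarrow> int \<Rightarrow> quat \<Rightarrow> quat \<Rightarrow> int \<Rightarrow> quat" where
  "initial_a M \<rho> k cp cm m =
     quat_of_complex ((cis (- pi / M) * of_real (cos (pi / M) / cos (theta M \<rho> k))) powi m)
     * (quat_of_complex (cis (- theta M \<rho> k * m)) * cp
        + quat_of_complex (cis (theta M \<rho> k * m)) * cm)"

definition A_fun :: "nat \<Rightarrow> nat \<Rightarrow> int \<Rightarrow> complex \<Rightarrow> int \<Rightarrow> complex" where
  "A_fun M \<rho> k c2 m = cis (theta M \<rho> k * m) + cis (- theta M \<rho> k * m) * c2"

definition B_fun :: "nat \<Rightarrow> nat \<Rightarrow> int \<Rightarrow> complex \<Rightarrow> int \<Rightarrow> complex" where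
  "B_fun M \<rho> k c2 m =
     cis (theta M \<rho> k * m) * of_real (sin ((\<rho> + k) * pi / (\<rho> * M)))
     + cis (- theta M \<rho> k * m) * of_real (sin ((\<rho> - k) * pi / (\<rho> * M))) * c2"

definition C_fun :: "nat \<Rightarrow> int \<Rightarrow> nat \<Rightarrow> int \<Rightarrow> complex \<Rightarrow> vertex \<Rightarrow> real" where
  "C_fun M N \<rho> k c2 = (\<lambda>(m, n). let s = sqrt (- spectral_parameter M \<rho> k) in
     2 * ((N - s) powi n + (N + s) powi n)\<^sup>2 * (cmod (B_fun M \<rho> k c2 m))\<^sup>2
     + ((N - s) powi n - (N + s) powi n)\<^sup>2 * (cmod (A_fun M \<rho> k c2 m))\<^sup>2
       * (cos (2 * pi / M) - cos (2 * k * pi / (\<rho> * M))))"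

definition T0_fun :: "nat \<Rightarrow> int \<Rightarrow> nat \<Rightarrow> int \<Rightarrow> complex \<Rightarrow> vertex \<Rightarrow> complex" where
  "T0_fun M N \<rho> k c2 = (\<lambda>(m, n). let s = sqrt (- spectral_parameter M \<rho> k) in
     \<i> / of_real s
     * of_real (((N - s) powi (2 * n) - (N + s) powi (2 * n))
         * (2 * (cmod (B_fun M \<rho> k c2 m))\<^sup>2
            + (cmod (A_fun M \<rho> k c2 m))\<^sup>2
              * (cos (2 * pi / M) - cos (2 * k * pi / (\<rho> * M))))))"

definition T1_fun :: "nat \<Rightarrow> int \<Rightarrow> nat \<Rightarrow> int \<Rightarrow> complex \<Rightarrow> vertex \<Rightarrow> complex" where
  "T1_fun M N \<rho> k c2 = (\<lambda>(m, n). let s = sqrt (- spectral_parameter M \<rho> k) in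
     - 16 * cis (2 * pi / M * m)
     * of_real ((N - s) powi n * (N + s) powi n * sin (pi / M) * cos (k * pi / (\<rho> * M)))
     * A_fun M \<rho> k c2 m * cnj (B_fun M \<rho> k c2 m))"

text \<open>The vertices at which the powers \<open>(N \<plusminus> sqrt (- \<nu>)) ^ n\<close> are meaningful. This is the whole
  lattice unless \<open>N\<^sup>2 = - \<nu>\<close>; in that exceptional case one of the two bases is \<open>0\<close> and
  the linearised Riccati equation is singular along the edges in the \<open>n\<close>-direction.\<close>

definition regular_vertices :: "int \<Rightarrow> real \<Rightarrow> vertex set" where
  "regular_vertices N \<nu> = {(m, n). 0 \<le> n \<or> (of_int N)\<^sup>2 \<noteq> - \<nu>}"

end

(* Along an edge with d = f_i - f_j and r = \<nu> / \<mu>, the differences T = fh - f satisfy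
   T_j - T_i - d + r T_j d^-1 T_i = 0, equivalently (r u - 1) (r v + 1) = r - 1 for u = d^-1 T_j and
   v = d^-1 T_i. Hence u and v commute, and fh_i - fh_j = r T_i d^-1 T_j = r T_j d^-1 T_i; these
   two orders make the T's cancel in the cross-ratios of fh. The same relation says that
   T = a b^-1 propagates along the linear equation. On the circle n = 0 that equation reduces to a
   complex one with eigenfunctions lam^m cis (\<plusminus> \<theta> m), which gives A and B; in the n-direction it
   has constant coefficients and eigenvalues 1 \<plusminus> s / N with s = sqrt (- \<nu>). If N^2 = - \<nu>, then
   r = 1 on the vertical edges, the relation factorises, and T is constant for n < 0. *)

theory Submission
  imports Defs
begin

section \<open>Quaternions as pairs of complex numbers\<close>

text \<open>With \<open>quat_J\<close> on the left of its coefficient, each quaternion identity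
  becomes two complex ones; conjugates appear exactly where a complex factor passes
  \<open>quat_J\<close>.\<close>

definition quat_pair :: "complex \<Rightarrow> complex \<Rightarrow> quat" where
  "quat_pair z w = quat_of_complex z + quat_J * quat_of_complex w"

lemma quat_pair_eq: "quat_pair z w = Quat (Re z) (Im z) (Re w) (- Im w)"
  by (simp add: quat_pair_def quat_of_complex_def quat_J_def plus_quat_def times_quat_def)

lemma quat_pair_eq_iff [simp]: "quat_pair z w = quat_pair z' w' \<longleftrightarrow> z = z' \<and> w = w'"
  by (auto simp: quat_pair_eq complex_eq_iff)

lemma of_real_quat: "of_real r = quat_pair (of_real r) 0"
  by (simp add: of_real_def scaleR_quat_def one_quat_def quat_pair_eq)

lemma zero_quat_pair: "0 = quat_pair 0 0"
  by (simp add: zero_quat_def quat_pair_eq)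

lemma one_quat_pair: "1 = quat_pair 1 0"
  by (simp add: one_quat_def quat_pair_eq)

lemma quat_pair_eq_0_iff [simp]: "quat_pair z w = 0 \<longleftrightarrow> z = 0 \<and> w = 0"
  by (simp add: zero_quat_pair)

lemma quat_pair_arith [simp]:
  "quat_pair z w + quat_pair z' w' = quat_pair (z + z') (w + w')"
  "quat_pair z w - quat_pair z' w' = quat_pair (z - z') (w - w')"
  "- quat_pair z w = quat_pair (- z) (- w)"
  "quat_pair z w * quat_pair z' w' = quat_pair (z * z' - cnj w * w') (cnj z * w' + w * z')"
  by (simp_all add: quat_pair_eq plus_quat_def minus_quat_def uminus_quat_def times_quat_def)

lemma inverse_quat_pair_complex: "inverse (quat_pair z 0) = quat_pair (inverse z) 0"
proof (cases "z = 0")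
  case True
  then show ?thesis by (simp flip: zero_quat_pair)
next
  case False
  then show ?thesis
    by (intro inverse_unique) (simp add: one_quat_pair)
qed

lemma inverse_quat_pair_J:
  "w \<noteq> 0 \<Longrightarrow> inverse (quat_pair 0 w) = quat_pair 0 (- inverse (cnj w))"
  by (intro inverse_unique) (simp add: one_quat_pair)

lemma span_J_K_E:
  assumes "x \<in> span {quat_J, quat_K}"
  obtains z where "x = quat_pair 0 z"
proof -
  obtain s t where "x - s *\<^sub>R quat_J = t *\<^sub>R quat_K"
    using assms by (auto simp: span_breakdown_eq)
  \<comment> \<open>\<open>quat_J * \<i>\<close> is \<open>- quat_K\<close>, hence the sign of the
    imaginary part.\<close>
  then have "x = quat_pair 0 (Complex s (- t))"
    by (simp add: quat_pair_eq quat_eq_iff minus_quat_def scaleR_quat_def quat_J_def quat_K_def)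
  then show thesis by (rule that)
qed

lemma cylinder_eq:
  "cylinder M N (m, n) = quat_pair (\<i> * of_real (of_int n / of_int N)) (cis (2 * pi / M * m))"
  by (simp add: cylinder_def quat_pair_def)

section \<open>A single edge of a Darboux transform\<close>

text \<open>A nonzero \<open>x\<close> gives \<open>y = inverse x * c\<close>, and the real number
  \<open>c\<close> is central; \<open>x = 0\<close> forces \<open>c = 0\<close>. This turns the
  product form of the edge relation into a commutation rule.\<close>

lemma mult_eq_of_real_commute:
  fixes x y :: "'a :: real_div_algebra"
  assumes "x * y = of_real c"
  shows "y * x = of_real c"
proof (cases "x = 0")
  case True
  then show ?thesis using assms by simp
next
  case False
  then have "y = inverse x * of_real c"
    using assms by (simp add: mult.assoc[symmetric] flip: assms)
  also have "\<dots> = of_real c * inverse x"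
    by (metis Reals_of_real mult.commute mult_scaleR_left mult_scaleR_right scaleR_conv_of_real mult_1_left mult_1_right)
  finally show ?thesis using False by (simp add: mult.assoc)
qed

text \<open>Distinctness holds because \<open>inverse 0 = 0\<close> would make the cross-ratio
  vanish. The equation arises by cancelling the outer factors of the cross-ratio, whose real value
  commutes with everything.\<close>

lemma darboux_edge:
  fixes p q p' q' :: quat
  assumes cr: "cross_ratio p q q' p' = of_real r" and r: "r \<noteq> 0"
  shows "p \<noteq> q" "q \<noteq> q'" "p \<noteq> p'"
    "q' - p' = - (r *\<^sub>R ((q' - q) * inverse (p - q) * (p' - p)))"
proof -
  show ne: "p \<noteq> q" "q \<noteq> q'" "p \<noteq> p'"
    using assms by (auto simp: cross_ratio_def)
  have "(q' - q) * inverse (p - q) * cross_ratio p q q' p' * (p' - p)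
      = (q' - q) * (inverse (p - q) * (p - q)) * inverse (q - q') * (q' - p')
          * (inverse (p' - p) * (p' - p))"
    by (simp add: cross_ratio_def mult.assoc)
  also have "\<dots> = (q' - q) * inverse (q - q') * (q' - p')"
    using ne by simp
  also have "(q' - q) * inverse (q - q') = - 1"
    using ne by (metis minus_diff_eq mult_minus_left right_inverse right_minus_eq)
  finally show "q' - p' = - (r *\<^sub>R ((q' - q) * inverse (p - q) * (p' - p)))"
    by (simp add: cr of_real_def)
qed

text \<open>The edge relation reads \<open>r u v = v - u + 1\<close>, which becomes a product after
  multiplication by \<open>r\<close> and completion. For \<open>r = 1\<close> the right-hand side
  vanishes, which is the singular case of the vertical edges.\<close>

lemma darboux_edge_product:
  fixes p q p' q' :: quat
  assumes cr: "cross_ratio p q q' p' = of_real r" and r: "r \<noteq> 0"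
  shows "(r *\<^sub>R (inverse (p - q) * (q' - q)) - 1) * (r *\<^sub>R (inverse (p - q) * (p' - p)) + 1)
    = of_real (r - 1)"
proof -
  define d where "d = inverse (p - q)"
  have ne: "p \<noteq> q" using darboux_edge[OF assms] by simp
  have "d * (q' - p') = - (r *\<^sub>R (d * (q' - q) * (d * (p' - p))))"
    using darboux_edge(4)[OF assms] by (simp add: d_def mult.assoc)
  moreover have "d * (q' - p') = d * (q' - q) - d * (p' - p) - d * (p - q)"
    by (simp add: algebra_simps)
  moreover have "d * (p - q) = 1" using ne by (simp add: d_def)
  ultimately have *: "r *\<^sub>R (d * (q' - q) * (d * (p' - p))) = d * (p' - p) - d * (q' - q) + 1"
    by (simp add: algebra_simps)
  define u v where "u = d * (q' - q)" and "v = d * (p' - p)"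
  have uv: "r *\<^sub>R (u * v) = v - u + 1" using * by (simp only: u_def v_def)
  have "(r *\<^sub>R u - 1) * (r *\<^sub>R v + 1) = r *\<^sub>R (r *\<^sub>R (u * v)) + r *\<^sub>R u - r *\<^sub>R v - 1"
    by (simp add: algebra_simps)
  also have "\<dots> = of_real (r - 1)"
    unfolding uv by (simp add: algebra_simps of_real_def)
  finally show ?thesis by (simp add: u_def v_def d_def)
qed

text \<open>Two factors with a real product commute, so \<open>u\<close> and \<open>v\<close>
  commute as \<open>r \<noteq> 0\<close>; multiplying by \<open>p - q\<close> exchanges the outer
  factors in \<open>darboux_edge\<close>.\<close>

lemma darboux_edge_swap:
  fixes p q p' q' :: quat
  assumes cr: "cross_ratio p q q' p' = of_real r" and r: "r \<noteq> 0"
  shows "q' - p' = - (r *\<^sub>R ((p' - p) * inverse (p - q) * (q' - q)))"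
proof -
  define d u v where "d = inverse (p - q)" and "u = d * (q' - q)" and "v = d * (p' - p)"
  have ne: "p \<noteq> q" using darboux_edge[OF assms] by simp
  have "(r *\<^sub>R u - 1) * (r *\<^sub>R v + 1) = (r *\<^sub>R v + 1) * (r *\<^sub>R u - 1)"
    using darboux_edge_product[OF assms] mult_eq_of_real_commute[OF darboux_edge_product[OF assms]]
    by (simp add: d_def u_def v_def)
  then have "(r * r) *\<^sub>R (u * v) = (r * r) *\<^sub>R (v * u)"
    by (simp add: algebra_simps)
  then have "u * v = v * u" using r by simp
  then have "(p - q) * (u * v) = (p - q) * (v * u)" by simp
  then have "(q' - q) * inverse (p - q) * (p' - p) = (p' - p) * inverse (p - q) * (q' - q)"
    using ne by (simp add: u_def v_def d_def mult.assoc[symmetric])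
  then show ?thesis using darboux_edge(4)[OF assms] by simp
qed

text \<open>Inserting \<open>b'\<close> produces \<open>r S d^-1 T\<close>, which the edge relation
  replaces by \<open>d + T - S\<close>; the terms in \<open>S\<close> cancel and
  \<open>(d + T) b\<close> remains. Nothing is divided by \<open>r - 1\<close>, so edges with
  \<open>r = 1\<close> are covered.\<close>

lemma riccati_forward:
  fixes p q p' q' :: quat
  assumes cr: "cross_ratio p q q' p' = of_real r" and r: "r \<noteq> 0"
    and a': "a - a' = - (p - q) * b" and b': "b - b' = - of_real r * inverse (p - q) * a"
    and T: "a = (p' - p) * b"
  shows "a' = (q' - q) * b'"
proof -
  define d S T where "d = p - q" and "S = q' - q" and "T = p' - p"
  have "b' = b + r *\<^sub>R (inverse d * a)"
    using b' by (simp add: of_real_def algebra_simps d_def)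
  then have "S * b' = S * b + (r *\<^sub>R (S * inverse d * T)) * b"
    by (simp add: T T_def[symmetric] algebra_simps)
  also have "r *\<^sub>R (S * inverse d * T) = d + T - S"
    using darboux_edge(4)[OF cr r] by (simp add: d_def S_def T_def algebra_simps)
  also have "S * b + (d + T - S) * b = a'"
    using a' T by (simp add: d_def T_def algebra_simps)
  finally show ?thesis by (simp add: S_def)
qed

text \<open>Both the linear equation and the edge relation have the left factor
  \<open>x = 1 - r S d^-1\<close>: one gives \<open>x a = (S - d) b\<close>, the other
  \<open>x T = S - d\<close>. If \<open>x\<close> vanished, then \<open>S = d\<close> and hence
  \<open>r = 1\<close>.\<close>

lemma riccati_backward:
  fixes p q p' q' :: quat
  assumes cr: "cross_ratio p q q' p' = of_real r" and r: "r \<noteq> 0" "r \<noteq> 1"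
    and a': "a - a' = - (p - q) * b" and b': "b - b' = - of_real r * inverse (p - q) * a"
    and T: "a' = (q' - q) * b'"
  shows "a = (p' - p) * b"
proof -
  define d S T where "d = p - q" and "S = q' - q" and "T = p' - p"
  define x where "x = 1 - r *\<^sub>R (S * inverse d)"
  have ne: "d \<noteq> 0" using darboux_edge(1)[OF cr r(1)] by (simp add: d_def)
  have b'eq: "b' = b + r *\<^sub>R (inverse d * a)"
    using b' by (simp add: of_real_def algebra_simps d_def)
  have "a + d * b = S * b'"
    using a' assms(6) by (simp add: d_def S_def algebra_simps)
  then have 1: "x * a = (S - d) * b"
    unfolding b'eq by (simp add: algebra_simps x_def)
  have "S - T - d = - (r *\<^sub>R (S * inverse d * T))"
    using darboux_edge(4)[OF cr r(1)] by (simp add: d_def S_def T_def algebra_simps)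
  then have 2: "x * T = S - d"
    by (simp add: x_def algebra_simps)
  have "x * (a - T * b) = 0"
    using 1 2 by (simp add: right_diff_distrib mult.assoc[symmetric])
  moreover have "x \<noteq> 0"
  proof
    assume "x = 0"
    then have "S = d" using 2 by simp
    then have "(1 - r) *\<^sub>R (1::quat) = 0"
      using \<open>x = 0\<close> ne by (simp add: x_def algebra_simps)
    then show False using r by simp
  qed
  ultimately show ?thesis by (simp add: T_def)
qed

section \<open>The cylinder and its Darboux transforms are isothermic\<close>

lemma norm_cis_diff: "cmod (cis x - cis y) = cmod (1 - cis (y - x))"
proof -
  have "cis x - cis y = cis x * (1 - cis (y - x))"
    by (simp add: right_diff_distrib cis_mult)
  then show ?thesis by (simp add: norm_mult)
qed

lemma norm_cylinder_step:
  "cmod (cis (2 * pi / real M * real_of_int m) - cis (2 * pi / real M * real_of_int (m + 1)))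
    = cmod (1 - cis (2 * pi / M))"
proof -
  have "2 * pi / real M * real_of_int (m + 1) - 2 * pi / real M * real_of_int m = 2 * pi / M"
    by (simp add: distrib_left)
  then show ?thesis by (simp only: norm_cis_diff)
qed

lemma factorising_function_cylinder_mu: "factorising_function (cylinder_mu M N)"
  by (auto simp: factorising_function_def edge_def quadrilateral_def cylinder_mu_def)

text \<open>Every elementary quadrilateral is a rectangle with sides \<open>quat_J * d\<close> and a
  multiple of \<i>. Moving \<open>quat_J\<close> past \<open>d\<close> produces
  \<open>d * cnj d\<close>, the squared length of the horizontal side.\<close>

lemma discrete_isothermic_cylinder:
  assumes "M > 2" "N \<noteq> 0"
  shows "discrete_isothermic (cylinder M N) (cylinder_mu M N)"
  unfolding discrete_isothermic_def
proof (intro conjI allI impI factorising_function_cylinder_mu)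
  fix i j k l
  assume "quadrilateral i j k l"
  then obtain m n where v: "i = (m, n)" "j = (m + 1, n)" "k = (m + 1, n + 1)" "l = (m, n + 1)"
    by (auto simp: quadrilateral_def)
  define e where "e = (\<lambda>m. cis (2 * pi / M * real_of_int m))"
  have f: "cylinder M N (m, n) = quat_pair (\<i> * of_real (of_int n / of_int N)) (e m)" for m n
    by (simp add: cylinder_eq e_def)
  have ne: "of_int (n + 1) / of_int N - of_int n / of_int N = (1 / of_int N :: real)" for n :: int
    by (simp flip: diff_divide_distrib)
  define d where "d = e m - e (m + 1)"
  have norm: "d * cnj d = of_real ((cmod (1 - cis (2 * pi / M)))\<^sup>2)"
    unfolding norm_cylinder_step[of M m, symmetric] complex_norm_square d_def e_def ..
  have 1: "cylinder M N i - cylinder M N j = quat_pair 0 d"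
    "cylinder M N k - cylinder M N l = quat_pair 0 (- d)"
    by (simp_all add: v f d_def)
  have 2: "cylinder M N j - cylinder M N k = quat_pair (- (\<i> / of_int N)) 0"
    "cylinder M N l - cylinder M N i = quat_pair (\<i> / of_int N) 0"
    by (simp_all add: v f add_divide_distrib algebra_simps)
  show "cross_ratio (cylinder M N i) (cylinder M N j) (cylinder M N k) (cylinder M N l)
      = of_real (cylinder_mu M N i l / cylinder_mu M N i j)"
    unfolding cross_ratio_def 1 2 inverse_quat_pair_complex
    using norm assms by (simp add: of_real_quat v cylinder_mu_def mult_ac power2_eq_square)
qed

text \<open>For parallelograms the same \<open>d\<close> and \<open>e\<close> serve opposite edges.
  After the \<open>T\<close> factors cancel, a conjugate of \<open>(d^-1 e)^2 = 1 / q\<close>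
  remains, with real factor \<open>(x / y)^2 = q^2\<close>.\<close>

lemma discrete_isothermic_darboux_transform:
  assumes iso: "discrete_isothermic f \<mu>" and dt: "darboux_transform f \<mu> \<nu> fh"
    and \<mu>: "\<And>v w. edge v w \<Longrightarrow> \<mu> v w \<noteq> 0" and \<nu>: "\<nu> \<noteq> 0"
    and par: "\<And>i j k l. quadrilateral i j k l \<Longrightarrow> f i - f j = f l - f k"
  shows "discrete_isothermic fh \<mu>"
  unfolding discrete_isothermic_def
proof (intro conjI allI impI)
  show ff: "factorising_function \<mu>" using iso by (simp add: discrete_isothermic_def)
  fix i j k l
  assume quad: "quadrilateral i j k l"
  then have edges: "edge i j" "edge j k" "edge l k" "edge i l"
    by (auto simp: quadrilateral_def edge_def)
  have \<mu>_eq: "\<mu> l k = \<mu> i j" "\<mu> j k = \<mu> i l"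
    using ff quad edges by (metis factorising_function_def)+
  define x y where "x = \<nu> / \<mu> i j" and "y = \<nu> / \<mu> i l"
  have nz: "x \<noteq> 0" "y \<noteq> 0" using \<mu> \<nu> edges by (auto simp: x_def y_def)
  define d e where "d = f i - f j" and "e = f i - f l"
  have de: "f l - f k = d" "f j - f k = e"
    using par[OF quad] by (simp_all add: d_def e_def algebra_simps)
  define T where "T = (\<lambda>v. fh v - f v)"
  have dt': "cross_ratio (f v) (f w) (fh w) (fh v) = of_real (\<nu> / \<mu> v w)" if "edge v w" for v w
    using dt that by (simp only: darboux_transform_def)
  have cr: "cross_ratio (f i) (f j) (fh j) (fh i) = of_real x"
    "cross_ratio (f l) (f k) (fh k) (fh l) = of_real x"
    "cross_ratio (f i) (f l) (fh l) (fh i) = of_real y"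
    "cross_ratio (f j) (f k) (fh k) (fh j) = of_real y"
    using edges[THEN dt'] by (simp_all only: x_def y_def \<mu>_eq)
  have Tnz: "T i \<noteq> 0" "T j \<noteq> 0" "T k \<noteq> 0" "T l \<noteq> 0" and dnz: "d \<noteq> 0" "e \<noteq> 0"
    using darboux_edge[OF cr(1) nz(1)] darboux_edge[OF cr(2) nz(1)] darboux_edge[OF cr(3) nz(2)]
    by (auto simp: T_def d_def e_def)
  \<comment> \<open>The order of the \<open>T\<close> factors on each edge is chosen so that in the
    cross-ratio \<open>T j\<close>, \<open>T k\<close>, \<open>T l\<close> meet their inverses and
    \<open>T i\<close> stands at both ends.\<close>
  have ij: "fh i - fh j = x *\<^sub>R (T i * inverse d * T j)"
    using darboux_edge_swap[OF cr(1) nz(1)] by (simp add: T_def d_def algebra_simps)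
  have kl: "fh k - fh l = - (x *\<^sub>R (T k * inverse d * T l))"
    using darboux_edge(4)[OF cr(2) nz(1)] de by (simp add: T_def)
  have jk: "fh j - fh k = y *\<^sub>R (T k * inverse e * T j)"
    using darboux_edge(4)[OF cr(4) nz(2)] de by (simp add: T_def algebra_simps)
  have li: "fh l - fh i = - (y *\<^sub>R (T i * inverse e * T l))"
    using darboux_edge_swap[OF cr(3) nz(2)] by (simp add: T_def e_def)
  have inv: "inverse (y *\<^sub>R (a * inverse e * b)) = (1 / y) *\<^sub>R (inverse b * e * inverse a)"
    if "a \<noteq> 0" "b \<noteq> 0" for a b
    using that nz dnz by (simp add: nonzero_inverse_scaleR_distrib nonzero_inverse_mult_distrib mult.assoc
        divide_inverse)
  define q where "q = \<mu> i l / \<mu> i j"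
  have qeq: "q = x / y" using \<nu> by (simp add: q_def x_def y_def)
  have qnz: "q \<noteq> 0" using nz by (simp add: qeq)
  have "cross_ratio (f i) (f j) (f k) (f l) = of_real q"
    using iso quad unfolding discrete_isothermic_def q_def by blast
  moreover have "f k - f l = - d" "f l - f i = - e" using de by (auto simp: e_def)
  ultimately have "d * inverse e * d * inverse e = q *\<^sub>R 1"
    using de by (simp add: cross_ratio_def d_def[symmetric] of_real_def mult.assoc)
  then have "inverse (d * inverse e * d * inverse e) = (1 / q) *\<^sub>R 1"
    using qnz by (simp add: nonzero_inverse_scaleR_distrib divide_inverse)
  then have inv_q: "e * inverse d * e * inverse d = (1 / q) *\<^sub>R 1"
    using dnz by (simp add: nonzero_inverse_mult_distrib mult.assoc)
  \<comment> \<open>Conjugation by \<open>d\<close> fixes the real value and rotates the word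
    cyclically into the order needed below.\<close>
  have "inverse d * (e * inverse d * e * inverse d) * d = inverse d * ((1 / q) *\<^sub>R 1) * d"
    by (simp only: inv_q)
  then have core: "inverse d * e * inverse d * e = (1 / q) *\<^sub>R 1"
    using dnz by (simp add: mult.assoc)
  have "cross_ratio (fh i) (fh j) (fh k) (fh l)
      = (x * x * (1 / y) * (1 / y)) *\<^sub>R (T i * inverse d * (T j * inverse (T j)) * e
          * (inverse (T k) * T k) * inverse d * (T l * inverse (T l)) * e * inverse (T i))"
    unfolding cross_ratio_def ij kl jk li inverse_minus_eq inv[OF Tnz(3,2)] inv[OF Tnz(1,4)]
    by (simp add: mult.assoc)
  also have "\<dots> = (x * x * (1 / y) * (1 / y)) *\<^sub>R (T i * (inverse d * e * inverse d * e) * inverse (T i))"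
    using Tnz by (simp add: mult.assoc)
  also have "\<dots> = of_real q"
    unfolding core using Tnz nz by (simp add: qeq of_real_def)
  finally show "cross_ratio (fh i) (fh j) (fh k) (fh l) = of_real (\<mu> i l / \<mu> i j)"
    by (simp add: q_def)
qed

section \<open>The closed form\<close>

text \<open>One horizontal step of a single eigenfunction; used with \<theta> and with - \<theta>
  for the two terms of \<open>A\<close> and \<open>B\<close>. The factor
  \<open>1 - (cos p)^2 / (cos \<theta>)^2\<close> is the ratio of \<nu> to \<mu> on a horizontal
  edge, see \<open>r_eq\<close>.\<close>

lemma cis_step_identities:
  fixes p \<theta> :: real
  assumes "cos \<theta> \<noteq> 0"
  shows "cis p * of_real (cos p / cos \<theta>) * cis \<theta> - 1
      = \<i> * cis p * of_real (sin (p + \<theta>) / cos \<theta>)"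
    and "cis p * of_real (cos p / cos \<theta>) * cis \<theta> * of_real (sin (p + \<theta>))
      = cis (2 * p) * of_real (sin (p + \<theta>))
        - \<i> * cis p * of_real (cos \<theta> * (1 - (cos p)\<^sup>2 / (cos \<theta>)\<^sup>2))"
proof -
  have sp: "sin p * sin p = 1 - cos p * cos p" and st: "sin \<theta> * sin \<theta> = 1 - cos \<theta> * cos \<theta>"
    using sin_squared_eq[of p] sin_squared_eq[of \<theta>] by (simp_all add: power2_eq_square)
  show "cis p * of_real (cos p / cos \<theta>) * cis \<theta> - 1
      = \<i> * cis p * of_real (sin (p + \<theta>) / cos \<theta>)"
    using assms by (simp add: complex_eq_iff sin_add field_simps) (use sp in algebra)
  have "of_real (cos p / cos \<theta>) * cis \<theta> * of_real (sin (p + \<theta>))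
      = cis p * of_real (sin (p + \<theta>)) - \<i> * of_real (cos \<theta> * (1 - (cos p)\<^sup>2 / (cos \<theta>)\<^sup>2))"
    using assms by (simp add: complex_eq_iff sin_add field_simps power2_eq_square)
      (use sp st in algebra)
  then have "cis p * (of_real (cos p / cos \<theta>) * cis \<theta> * of_real (sin (p + \<theta>)))
      = cis p * (cis p * of_real (sin (p + \<theta>))
        - \<i> * of_real (cos \<theta> * (1 - (cos p)\<^sup>2 / (cos \<theta>)\<^sup>2)))"
    by simp
  then show "cis p * of_real (cos p / cos \<theta>) * cis \<theta> * of_real (sin (p + \<theta>))
      = cis (2 * p) * of_real (sin (p + \<theta>))
        - \<i> * cis p * of_real (cos \<theta> * (1 - (cos p)\<^sup>2 / (cos \<theta>)\<^sup>2))"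
    by (simp add: right_diff_distrib mult_ac cis_mult flip: mult_2)
qed

section \<open>Trigonometry of the spectral parameter\<close>

locale spectral_cylinder =
  fixes M \<rho> :: nat and N \<kappa> :: int
  assumes M: "M > 2" and N: "N \<noteq> 0" and \<rho>: "\<rho> > 0"
    and spectral_neg: "spectral_parameter M \<rho> \<kappa> < 0"
begin

definition p :: real where "p = pi / M"
definition \<theta> :: real where "\<theta> = theta M \<rho> \<kappa>"
definition s :: real where "s = sqrt (- spectral_parameter M \<rho> \<kappa>)"
definition D :: real where "D = 2 * sin p * cos \<theta>"
definition e :: "int \<Rightarrow> complex" where "e m = cis (2 * pi / M * m)"
text \<open>The value of \<nu> / \<mu> on horizontal edges, see
  \<open>ratio_horizontal\<close>.\<close>

definition r :: real where "r = - s\<^sup>2 * (cmod (1 - cis (2 * p)))\<^sup>2"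
text \<open>The conjugate of the base of the power in \<^const>\<open>initial_a\<close>, because
  \<open>z * quat_J = quat_J * cnj z\<close>.\<close>

definition lam :: complex where "lam = cis p * of_real (cos p / cos \<theta>)"

lemma p_bounds: "0 < p" "p < pi / 2"
  using M by (simp_all add: p_def field_simps)

lemma trig_p: "sin p > 0" "cos p > 0"
  using p_bounds by (auto intro: sin_gt_zero cos_gt_zero)

lemma s_pos: "s > 0" and s_squared: "s\<^sup>2 = - spectral_parameter M \<rho> \<kappa>"
  using spectral_neg by (simp_all add: s_def)

text \<open>If either vanished, \<open>tan \<theta>\<close> would be 0 (for the cosine by the
  convention on division by zero), and the spectral parameter would be 1/4.\<close>

lemma trig_theta: "cos \<theta> \<noteq> 0" "sin \<theta> \<noteq> 0"
  using spectral_neg by (auto simp: spectral_parameter_def \<theta>_def tan_def)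

lemma D_nonzero: "D \<noteq> 0"
  using trig_p trig_theta by (simp add: D_def)

text \<open>Clearing denominators in the spectral parameter. This lets the difference of cosines in
  the closed form and the ratio \<open>r\<close> be written with \<open>s\<close> and
  \<open>D\<close>.\<close>

lemma s_D: "s\<^sup>2 * D\<^sup>2 = (sin \<theta>)\<^sup>2 - (sin p)\<^sup>2"
proof -
  have "4 * s\<^sup>2 = (cos p)\<^sup>2 * (sin \<theta>)\<^sup>2 / ((sin p)\<^sup>2 * (cos \<theta>)\<^sup>2) - 1"
    by (simp add: s_squared spectral_parameter_def cot_def tan_def power_divide
        diff_divide_distrib flip: p_def \<theta>_def)
  then have "4 * s\<^sup>2 * ((sin p)\<^sup>2 * (cos \<theta>)\<^sup>2) = (cos p)\<^sup>2 * (sin \<theta>)\<^sup>2 - (sin p)\<^sup>2 * (cos \<theta>)\<^sup>2"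
    using trig_p trig_theta by (simp add: left_diff_distrib)
  then show ?thesis
    by (simp add: D_def power_mult_distrib cos_squared_eq algebra_simps)
qed

lemma cos_diff_eq: "cos (2 * pi / M) - cos (2 * of_int \<kappa> * pi / (real \<rho> * real M)) = 2 * s\<^sup>2 * D\<^sup>2"
proof -
  have "2 * pi / M = 2 * p" "2 * of_int \<kappa> * pi / (real \<rho> * real M) = 2 * \<theta>"
    by (simp_all add: p_def \<theta>_def theta_def)
  then have "cos (2 * pi / M) - cos (2 * of_int \<kappa> * pi / (real \<rho> * real M)) = 2 * ((sin \<theta>)\<^sup>2 - (sin p)\<^sup>2)"
    by (simp only: cos_double_sin) simp
  then show ?thesis by (simp add: s_D mult.assoc)
qed

lemma one_minus_cis: "1 - cis (2 * p) = - 2 * \<i> * of_real (sin p) * cis p"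
  by (simp add: complex_eq_iff cos_double_sin sin_double power2_eq_square)

lemma norm_squared_step: "(cmod (1 - cis (2 * p)))\<^sup>2 = 4 * (sin p)\<^sup>2"
  by (simp add: one_minus_cis norm_mult power_mult_distrib)

lemma r_eq: "r = 1 - (cos p)\<^sup>2 / (cos \<theta>)\<^sup>2"
proof -
  have "r * (cos \<theta>)\<^sup>2 = - (s\<^sup>2 * D\<^sup>2)"
    by (simp add: r_def norm_squared_step D_def power_mult_distrib)
  also have "\<dots> = (cos \<theta>)\<^sup>2 - (cos p)\<^sup>2"
    by (simp add: s_D sin_squared_eq)
  finally show ?thesis using trig_theta by (simp add: field_simps)
qed

text \<open>Excludes both \<open>r = 0\<close> and \<open>r = 1\<close>, so horizontal Riccati steps
  can be taken in either direction.\<close>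

lemma r_neg: "r < 0"
proof -
  have "1 - cis (2 * p) \<noteq> 0"
    using norm_squared_step trig_p by auto
  then show ?thesis using s_pos by (simp add: r_def)
qed

section \<open>Solution of the horizontal equation on the initial circle\<close>

abbreviation "A \<equiv> A_fun M \<rho> \<kappa>"
abbreviation "B \<equiv> B_fun M \<rho> \<kappa>"

lemma A_eq: "A c m = cis (\<theta> * m) + cis (- \<theta> * m) * c"
  by (simp add: A_fun_def \<theta>_def)

lemma B_eq: "B c m = cis (\<theta> * m) * of_real (sin (p + \<theta>)) + cis (- \<theta> * m) * of_real (sin (p - \<theta>)) * c"
proof -
  have "(\<rho> + \<kappa>) * pi / (\<rho> * M) = p + \<theta>" "(\<rho> - \<kappa>) * pi / (\<rho> * M) = p - \<theta>"
    using \<rho> M by (simp_all add: p_def \<theta>_def theta_def field_simps)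
  then show ?thesis by (simp add: B_fun_def \<theta>_def)
qed

lemma cis_theta_Suc: "cis (t * of_int (m + 1)) = cis t * cis (t * of_int m)"
  by (simp add: cis_mult algebra_simps)

lemma A_step: "lam * A c (m + 1) = A c m + \<i> * cis p / of_real (cos \<theta>) * B c m"
proof -
  have 1: "lam * cis \<theta> = 1 + \<i> * cis p * of_real (sin (p + \<theta>) / cos \<theta>)"
    using cis_step_identities(1)[of \<theta> p] trig_theta by (simp add: lam_def algebra_simps)
  have 2: "lam * cis (- \<theta>) = 1 + \<i> * cis p * of_real (sin (p - \<theta>) / cos \<theta>)"
    using cis_step_identities(1)[of "- \<theta>" p] trig_theta by (simp add: lam_def algebra_simps)
  have "lam * A c (m + 1) = lam * cis \<theta> * cis (\<theta> * m) + lam * cis (- \<theta>) * cis (- \<theta> * m) * c"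
    unfolding A_eq cis_theta_Suc by (simp add: algebra_simps)
  then show ?thesis
    unfolding 1 2 by (simp add: A_eq B_eq algebra_simps add_divide_distrib)
qed

lemma B_step: "lam * B c (m + 1) = cis (2 * p) * B c m - \<i> * cis p * of_real (cos \<theta> * r) * A c m"
proof -
  have 1: "lam * cis \<theta> * of_real (sin (p + \<theta>))
      = cis (2 * p) * of_real (sin (p + \<theta>)) - \<i> * cis p * of_real (cos \<theta> * r)"
    using cis_step_identities(2)[of \<theta> p] trig_theta by (simp add: lam_def r_eq)
  have 2: "lam * cis (- \<theta>) * of_real (sin (p - \<theta>))
      = cis (2 * p) * of_real (sin (p - \<theta>)) - \<i> * cis p * of_real (cos \<theta> * r)"
    using cis_step_identities(2)[of "- \<theta>" p] trig_theta by (simp add: lam_def r_eq)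
  have "lam * B c (m + 1) = (lam * cis \<theta> * of_real (sin (p + \<theta>))) * cis (\<theta> * m)
      + (lam * cis (- \<theta>) * of_real (sin (p - \<theta>))) * cis (- \<theta> * m) * c"
    unfolding B_eq cis_theta_Suc by (simp add: algebra_simps)
  then show ?thesis
    unfolding 1 2 by (simp add: A_eq B_eq algebra_simps)
qed

definition \<alpha> :: "complex \<Rightarrow> int \<Rightarrow> complex" where "\<alpha> c m = lam powi m * A c m"
text \<open>Forced by the first Riccati equation: it is the increment of \<alpha> divided by
  \<open>e m - e (m + 1)\<close>, see \<open>\<alpha>_step\<close>.\<close>

definition \<beta> :: "complex \<Rightarrow> int \<Rightarrow> complex" where "\<beta> c m = - (lam powi m * B c m) / (of_real D * e m)"

lemma lam_nonzero: "lam \<noteq> 0"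
  using trig_p trig_theta by (simp add: lam_def)

lemma e_nonzero: "e m \<noteq> 0"
  by (simp add: e_def)

lemma e_Suc: "e (m + 1) = cis (2 * p) * e m"
  by (simp add: e_def p_def cis_mult distrib_left add.commute)

lemma e_diff: "e m - e (m + 1) = - 2 * \<i> * of_real (sin p) * cis p * e m"
proof -
  have "e m - e (m + 1) = (1 - cis (2 * p)) * e m" unfolding e_Suc by (simp add: algebra_simps)
  then show ?thesis by (simp add: one_minus_cis)
qed

lemma e_diff_nonzero: "e m - e (m + 1) \<noteq> 0"
  using trig_p by (simp add: e_diff e_nonzero)

lemma e_diff_norm: "(e m - e (m + 1)) * cnj (e m - e (m + 1)) * of_real (s\<^sup>2) = - of_real r"
proof -
  have "(e m - e (m + 1)) * cnj (e m - e (m + 1)) = of_real ((cmod (1 - cis (2 * p)))\<^sup>2)"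
    unfolding complex_norm_square[symmetric] unfolding e_def
    unfolding norm_cylinder_step by (simp add: p_def)
  then show ?thesis by (simp add: r_def)
qed

lemma \<alpha>_step: "\<alpha> c (m + 1) = \<alpha> c m + (e m - e (m + 1)) * \<beta> c m"
proof -
  have "\<alpha> c (m + 1) = lam powi m * (lam * A c (m + 1))"
    by (simp add: \<alpha>_def power_int_add_1 lam_nonzero)
  then show ?thesis
    unfolding A_step e_diff using trig_p trig_theta e_nonzero[of m]
    by (simp add: \<alpha>_def \<beta>_def D_def field_simps)
qed

lemma \<beta>_step: "\<beta> c (m + 1) = \<beta> c m + of_real r * \<alpha> c m / (e m - e (m + 1))"
proof -
  \<comment> \<open>The rational identity behind the step, with \<open>z = cis p\<close> and
    \<open>x = e m\<close>: the factor \<open>z * z\<close> of \<open>e (m + 1)\<close> cancels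
    against the one in \<open>B_step\<close>.\<close>
  have *: "- (L * (z * z * b - \<i> * z * of_real (cos \<theta> * r) * a)) / (of_real D * (z * z * x))
      = - (L * b) / (of_real D * x) + of_real r * (L * a) / (- 2 * \<i> * of_real (sin p) * z * x)"
    if "z \<noteq> 0" "x \<noteq> 0" for L z b a x :: complex
    using that trig_p trig_theta by (simp add: D_def field_simps)
  have "\<beta> c (m + 1) = - (lam powi m * (lam * B c (m + 1))) / (of_real D * e (m + 1))"
    by (simp add: \<beta>_def power_int_add_1 lam_nonzero)
  also have "cis (2 * p) = cis p * cis p" by (simp add: cis_mult)
  then have "- (lam powi m * (lam * B c (m + 1))) / (of_real D * e (m + 1))
      = \<beta> c m + of_real r * \<alpha> c m / (e m - e (m + 1))"
    unfolding B_step e_diff unfolding e_Suc \<alpha>_def \<beta>_def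
    by (simp only: * cis_neq_zero e_nonzero not_False_eq_True)
  finally show ?thesis .
qed

section \<open>Powers of the vertical step\<close>

definition P :: "int \<Rightarrow> real" where "P n = ((N + s) / N) powi n"
definition Q :: "int \<Rightarrow> real" where "Q n = ((N - s) / N) powi n"
definition g :: "int \<Rightarrow> real" where "g n = (P n + Q n) / 2"
definition h :: "int \<Rightarrow> real" where "h n = (P n - Q n) / (2 * s)"

abbreviation regular :: "int \<Rightarrow> bool" where "regular n \<equiv> 0 \<le> n \<or> (of_int N)\<^sup>2 \<noteq> s\<^sup>2"

lemma base_nonzero: "(of_int N)\<^sup>2 \<noteq> s\<^sup>2 \<Longrightarrow> (N + s) / N \<noteq> 0 \<and> (N - s) / N \<noteq> 0"
  using N by (auto simp: add_eq_0_iff2)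

text \<open>For base 0 the power rule fails only from -1 to 0, since \<open>0 powi (- 1) = 0\<close>
  but \<open>0 powi 0 = 1\<close>; regularity rules out a zero base at that row.\<close>

lemma PQ_step:
  assumes "regular n"
  shows "P (n + 1) = P n + s / N * P n" "Q (n + 1) = Q n - s / N * Q n"
proof -
  have "n \<noteq> - 1 \<or> (of_int N)\<^sup>2 \<noteq> s\<^sup>2" using assms by auto
  then have "(N + s) / N \<noteq> 0 \<or> n \<noteq> - 1" "(N - s) / N \<noteq> 0 \<or> n \<noteq> - 1"
    using base_nonzero by auto
  then have "P (n + 1) = P n * ((N + s) / N)" "Q (n + 1) = Q n * ((N - s) / N)"
    unfolding P_def Q_def by (simp_all only: power_int_add_1)
  then show "P (n + 1) = P n + s / N * P n" "Q (n + 1) = Q n - s / N * Q n"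
    using N by (simp_all only:) (simp_all add: field_simps)
qed

lemma gh_step:
  assumes "regular n"
  shows "g (n + 1) = g n + s\<^sup>2 / N * h n" "h (n + 1) = h n + g n / N"
  unfolding g_def h_def PQ_step[OF assms] using s_pos N
  by (simp_all add: power2_eq_square field_simps)

lemma gh_0: "g 0 = 1" "h 0 = 0"
  by (simp_all add: g_def h_def P_def Q_def)

text \<open>If both vanished, so would \<open>P n\<close> and \<open>Q n\<close>, hence both
  \<open>N + s\<close> and \<open>N - s\<close>, which forces \<open>N = 0\<close>. This keeps
  \<open>sol_b\<close> and \<open>C_fun\<close> away from 0.\<close>

lemma gh_nonzero:
  assumes "regular n"
  shows "g n \<noteq> 0 \<or> h n \<noteq> 0"
proof (rule ccontr)
  assume "\<not> (g n \<noteq> 0 \<or> h n \<noteq> 0)"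
  then have "P n = 0" "Q n = 0" using s_pos by (auto simp: g_def h_def)
  then have "real_of_int N + s = 0" "real_of_int N - s = 0"
    using N by (auto simp: P_def Q_def)
  then show False using N by simp
qed

text \<open>The vertical step matrix \<open>((1, - \<i> / N), (\<i> s\<^sup>2 / N, 1))\<close> has the \<open>n\<close>-th power
  \<open>((g n, - \<i> h n), (\<i> s\<^sup>2 h n, g n))\<close>, applied here to the row \<open>n = 0\<close>, where
  \<open>a = quat_J * \<alpha>\<close> and \<open>b = \<beta>\<close>.\<close>

definition sol_a :: "complex \<Rightarrow> vertex \<Rightarrow> quat" where
  "sol_a c = (\<lambda>(m, n). quat_pair (- \<i> * of_real (h n) * \<beta> c m) (of_real (g n) * \<alpha> c m))"

definition sol_b :: "complex \<Rightarrow> vertex \<Rightarrow> quat" where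
  "sol_b c = (\<lambda>(m, n). quat_pair (of_real (g n) * \<beta> c m) (- \<i> * of_real (s\<^sup>2 * h n) * \<alpha> c m))"

section \<open>The explicit solution of the linearised Riccati equation\<close>

lemma cylinder_horizontal:
  "cylinder M N (m, n) - cylinder M N (m + 1, n) = quat_pair 0 (e m - e (m + 1))"
  by (simp add: cylinder_eq e_def)

lemma cylinder_vertical:
  "cylinder M N (m, n) - cylinder M N (m, n + 1) = quat_pair (- \<i> / of_int N) 0"
  by (simp add: cylinder_eq add_divide_distrib algebra_simps)

lemma ratio_horizontal:
  "spectral_parameter M \<rho> \<kappa> / cylinder_mu M N (m, n) (m + 1, n) = r"
  by (simp add: cylinder_mu_def r_def s_squared p_def)

lemma ratio_vertical:
  "spectral_parameter M \<rho> \<kappa> / cylinder_mu M N (m, n) (m, n + 1) = s\<^sup>2 / (of_int N)\<^sup>2"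
  by (simp add: cylinder_mu_def s_squared)

lemma riccati_horizontal:
  fixes m n :: int
  defines "d \<equiv> cylinder M N (m, n) - cylinder M N (m + 1, n)"
  shows "sol_a c (m, n) - sol_a c (m + 1, n) = - d * sol_b c (m, n)"
    and "sol_b c (m, n) - sol_b c (m + 1, n) = - of_real r * inverse d * sol_a c (m, n)"
proof -
  define x where "x = e m - e (m + 1)"
  have x: "x \<noteq> 0" "cnj x \<noteq> 0" using e_diff_nonzero by (simp_all add: x_def)
  have r: "of_real r = - x * cnj x * of_real (s\<^sup>2)"
    using e_diff_norm[of m] unfolding x_def by (metis minus_equation_iff mult_minus_left)
  have d: "d = quat_pair 0 x" by (simp only: d_def x_def cylinder_horizontal)
  \<comment> \<open>Since \<open>r = - s^2 x cnj x\<close>, the division by \<open>x\<close>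
    disappears; the conjugate left over matches the one created by moving \<open>quat_J\<close> in
    the quaternion product.\<close>
  have \<beta>: "\<beta> c (m + 1) = \<beta> c m - of_real (s\<^sup>2) * cnj x * \<alpha> c m"
    using x unfolding \<beta>_step x_def[symmetric] r by simp
  have \<alpha>: "\<alpha> c (m + 1) = \<alpha> c m + x * \<beta> c m"
    by (simp only: \<alpha>_step x_def)
  show "sol_a c (m, n) - sol_a c (m + 1, n) = - d * sol_b c (m, n)"
    unfolding sol_a_def sol_b_def d case_prod_conv \<alpha> \<beta>
    by (simp add: algebra_simps)
  show "sol_b c (m, n) - sol_b c (m + 1, n) = - of_real r * inverse d * sol_a c (m, n)"
    unfolding sol_a_def sol_b_def d case_prod_conv \<alpha> \<beta> of_real_quat inverse_quat_pair_J[OF x(1)] r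
    using x by (simp add: field_simps)
qed

lemma riccati_vertical:
  fixes m n :: int
  defines "d \<equiv> \<lambda>n. cylinder M N (m, n) - cylinder M N (m, n + 1)"
  assumes n: "regular n"
  shows "sol_a c (m, n) - sol_a c (m, n + 1) = - d n * sol_b c (m, n)"
    and "sol_b c (m, n) - sol_b c (m, n + 1)
      = - of_real (s\<^sup>2 / (of_int N)\<^sup>2) * inverse (d n) * sol_a c (m, n)"
proof -
  have d: "d n = quat_pair (- \<i> / of_int N) 0" by (simp only: d_def cylinder_vertical)
  show "sol_a c (m, n) - sol_a c (m, n + 1) = - d n * sol_b c (m, n)"
    unfolding sol_a_def sol_b_def d case_prod_conv gh_step[OF n]
    using N by (simp add: field_simps)
  show "sol_b c (m, n) - sol_b c (m, n + 1)
      = - of_real (s\<^sup>2 / (of_int N)\<^sup>2) * inverse (d n) * sol_a c (m, n)"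
    unfolding sol_a_def sol_b_def d case_prod_conv gh_step[OF n] inverse_quat_pair_complex of_real_quat
    using N by (simp add: field_simps power2_eq_square)
qed

lemma linearised_riccati_sol:
  "linearised_riccati_on (regular_vertices N (spectral_parameter M \<rho> \<kappa>)) (cylinder M N)
     (cylinder_mu M N) (spectral_parameter M \<rho> \<kappa>) (sol_a c) (sol_b c)"
  unfolding linearised_riccati_on_def
proof (intro ballI impI)
  fix i j
  assume i: "i \<in> regular_vertices N (spectral_parameter M \<rho> \<kappa>)" and ij: "edge i j"
  obtain m n where mn: "i = (m, n)" by fastforce
  have n: "regular n" using i by (auto simp: mn regular_vertices_def s_squared)
  show "sol_a c i - sol_a c j = - (cylinder M N i - cylinder M N j) * sol_b c i \<and>
    sol_b c i - sol_b c j = - of_real (spectral_parameter M \<rho> \<kappa> / cylinder_mu M N i j)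
        * inverse (cylinder M N i - cylinder M N j) * sol_a c i"
    using ij unfolding edge_def mn fst_conv snd_conv
    by (elim disjE; simp only: riccati_horizontal riccati_vertical[OF n] ratio_horizontal
        ratio_vertical simp_thms)
qed

text \<open>Pulling \<open>quat_J\<close> to the left conjugates the complex coefficients, which
  turns the given base into \<open>lam\<close> and the two exponentials into those of
  \<open>A\<close>.\<close>

lemma sol_a_initial: "sol_a c (m, 0) = initial_a M \<rho> \<kappa> quat_J (quat_J * quat_of_complex c) m"
proof -
  have J: "quat_J = quat_pair 0 1" and C: "quat_of_complex z = quat_pair z 0" for z
    by (simp_all add: quat_pair_eq quat_J_def quat_of_complex_def)
  have lam: "lam = cnj (cis (- pi / M) * of_real (cos (pi / M) / cos (theta M \<rho> \<kappa>)))"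
    by (simp add: lam_def p_def \<theta>_def cis_cnj)
  show ?thesis
    unfolding initial_a_def J C
    by (simp add: sol_a_def gh_0 \<alpha>_def A_eq lam \<theta>_def cis_cnj)
qed

lemma sol_b_nonzero:
  assumes "regular n" "\<alpha> c m \<noteq> 0" "\<beta> c m \<noteq> 0"
  shows "sol_b c (m, n) \<noteq> 0"
  using gh_nonzero[OF assms(1)] assms s_pos by (auto simp: sol_b_def)

section \<open>The closed formulas in terms of \<open>g\<close> and \<open>h\<close>\<close>

lemma PQ_powers:
  "(N + s) powi n = of_int N powi n * (g n + s * h n)"
  "(N - s) powi n = of_int N powi n * (g n - s * h n)"
proof -
  have "g n + s * h n = P n" "g n - s * h n = Q n"
    using s_pos by (simp_all add: g_def h_def field_simps)
  then show "(N + s) powi n = of_int N powi n * (g n + s * h n)"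
    "(N - s) powi n = of_int N powi n * (g n - s * h n)"
    using N by (simp_all only:) (simp_all add: P_def Q_def power_int_divide_distrib)
qed

text \<open>The common factor of \<open>C_fun\<close>, \<open>T0_fun\<close> and
  \<open>T1_fun\<close>, which cancels in the quotient.\<close>

definition scale :: "int \<Rightarrow> real" where "scale n = 8 * (of_int N powi n)\<^sup>2"

lemma C_fun_eq:
  "C_fun M N \<rho> \<kappa> c (m, n) = scale n *
    ((g n)\<^sup>2 * (cmod (B c m))\<^sup>2 + s ^ 4 * (h n)\<^sup>2 * D\<^sup>2 * (cmod (A c m))\<^sup>2)"
  unfolding C_fun_def Let_def case_prod_conv of_nat_mult s_def[symmetric] PQ_powers cos_diff_eq scale_def
  by algebra

lemma T0_fun_eq:
  "T0_fun M N \<rho> \<kappa> c (m, n) = - \<i> * of_real (scale n * g n * h n *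
    ((cmod (B c m))\<^sup>2 + s\<^sup>2 * D\<^sup>2 * (cmod (A c m))\<^sup>2))"
proof -
  have sq: "x powi (2 * n) = (x powi n)\<^sup>2" for x :: real
    by (simp add: power_int_mult mult.commute[of 2 n])
  have "((N - s) powi (2 * n) - (N + s) powi (2 * n))
         * (2 * (cmod (B c m))\<^sup>2
            + (cmod (A c m))\<^sup>2 * (cos (2 * pi / M) - cos (2 * of_int \<kappa> * pi / (real \<rho> * real M))))
      = - (s * (scale n * g n * h n * ((cmod (B c m))\<^sup>2 + s\<^sup>2 * D\<^sup>2 * (cmod (A c m))\<^sup>2)))"
    unfolding sq PQ_powers cos_diff_eq scale_def by algebra
  then show ?thesis
    unfolding T0_fun_def Let_def case_prod_conv of_nat_mult s_def[symmetric] using s_pos by simp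
qed

lemma T1_fun_eq:
  "T1_fun M N \<rho> \<kappa> c (m, n) = - of_real (scale n * ((g n)\<^sup>2 - s\<^sup>2 * (h n)\<^sup>2) * D)
    * e m * A c m * cnj (B c m)"
proof -
  define x where "x = (N - s) powi n * (N + s) powi n * sin (pi / M) * cos (\<kappa> * pi / (real \<rho> * real M))"
  have x: "2 * x = (of_int N powi n)\<^sup>2 * ((g n)\<^sup>2 - s\<^sup>2 * (h n)\<^sup>2) * D"
    unfolding x_def PQ_powers D_def p_def \<theta>_def theta_def of_nat_mult by algebra
  have "16 * x = scale n * ((g n)\<^sup>2 - s\<^sup>2 * (h n)\<^sup>2) * D"
    using x unfolding scale_def by algebra
  then have "- 16 * of_real x = (- of_real (scale n * ((g n)\<^sup>2 - s\<^sup>2 * (h n)\<^sup>2) * D) :: complex)"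
    by (metis mult_minus_left of_real_mult of_real_numeral)
  then show ?thesis
    unfolding T1_fun_def Let_def case_prod_conv of_nat_mult s_def[symmetric] e_def x_def by algebra
qed

lemma closed_form:
  assumes reg: "regular n" and "\<alpha> c m \<noteq> 0" "\<beta> c m \<noteq> 0"
  shows "C_fun M N \<rho> \<kappa> c (m, n) \<noteq> 0"
    and "sol_a c (m, n) * inverse (sol_b c (m, n)) = of_real (1 / C_fun M N \<rho> \<kappa> c (m, n))
      * quat_pair (T0_fun M N \<rho> \<kappa> c (m, n)) (T1_fun M N \<rho> \<kappa> c (m, n))"
proof -
  let ?C = "C_fun M N \<rho> \<kappa> c (m, n)"
  let ?T0 = "T0_fun M N \<rho> \<kappa> c (m, n)" and ?T1 = "T1_fun M N \<rho> \<kappa> c (m, n)"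
  have AB: "A c m \<noteq> 0" "B c m \<noteq> 0" using assms by (auto simp: \<alpha>_def \<beta>_def)
  have "(g n)\<^sup>2 * (cmod (B c m))\<^sup>2 + s ^ 4 * (h n)\<^sup>2 * D\<^sup>2 * (cmod (A c m))\<^sup>2 > 0"
    using gh_nonzero[OF reg] AB s_pos D_nonzero
    by (auto intro: add_pos_nonneg add_nonneg_pos)
  moreover have "scale n > 0" using N by (simp add: scale_def)
  ultimately show C: "?C \<noteq> 0" by (simp add: C_fun_eq)
  define L where "L = lam powi m"
  define a b where "a = A c m" and "b = B c m"
  have norms: "of_real ((cmod a)\<^sup>2) = a * cnj a" "of_real ((cmod b)\<^sup>2) = b * cnj b"
    by (simp_all only: complex_norm_square)
  have ee: "cnj (e m) = 1 / e m" using e_nonzero by (simp add: e_def cis_cnj divide_complex_def)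
  have C_eq: "of_real ?C = of_real (scale n) * ((of_real (g n))\<^sup>2 * (b * cnj b)
      + (of_real s) ^ 4 * (of_real (h n))\<^sup>2 * (of_real D)\<^sup>2 * (a * cnj a))"
    unfolding C_fun_eq a_def[symmetric] b_def[symmetric] norms[symmetric] by simp
  have T0_eq: "?T0 = - \<i> * of_real (scale n) * of_real (g n) * of_real (h n)
      * (b * cnj b + (of_real s)\<^sup>2 * (of_real D)\<^sup>2 * (a * cnj a))"
    unfolding T0_fun_eq a_def[symmetric] b_def[symmetric] norms[symmetric] by simp
  have T1_eq: "?T1 = - of_real (scale n) * ((of_real (g n))\<^sup>2 - (of_real s)\<^sup>2 * (of_real (h n))\<^sup>2)
      * of_real D * e m * a * cnj b"
    unfolding T1_fun_eq a_def[symmetric] b_def[symmetric] by simp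
  \<comment> \<open>This is minus \<beta>. Kept as a variable with
    \<open>L * b = w * D * e m\<close>, it makes the two component identities polynomial, conjugates
    being treated as independent variables.\<close>
  define w where "w = L * b / (of_real D * e m)"
  have Lb: "L * b = w * of_real D * e m"
    using D_nonzero e_nonzero by (simp add: w_def)
  have \<alpha>\<beta>: "\<alpha> c m = L * a" "\<beta> c m = - w"
    by (simp_all add: \<alpha>_def \<beta>_def L_def a_def b_def w_def)
  have id1: "(- i * k * g * h * (b * cb + s\<^sup>2 * D\<^sup>2 * (a * ca))) * (g * (- w))
      - (- k * (g\<^sup>2 - s\<^sup>2 * h\<^sup>2) * D * ce * ca * b) * (- i * (s\<^sup>2 * h) * (L * a))
      = k * (g\<^sup>2 * (b * cb) + s ^ 4 * h\<^sup>2 * D\<^sup>2 * (a * ca)) * (- i * h * (- w))"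
    if "L * b = w * D * x" "x * ce = 1"
    for i k g h b cb s D a ca w ce x L :: complex
    using that by algebra
  have id2: "(i * k * g * h * (b * cb + s\<^sup>2 * D\<^sup>2 * (a * ca))) * (- i * (s\<^sup>2 * h) * (L * a))
      + (- k * (g\<^sup>2 - s\<^sup>2 * h\<^sup>2) * D * x * a * cb) * (g * (- w))
      = k * (g\<^sup>2 * (b * cb) + s ^ 4 * h\<^sup>2 * D\<^sup>2 * (a * ca)) * (g * (L * a))"
    if "L * b = w * D * x" "i * i = - 1"
    for i k g h b cb s D a ca w x L :: complex
    using that by algebra
  \<comment> \<open>Checking the product avoids inverting the quaternion \<open>sol_b\<close>;
    \<open>id1\<close> and \<open>id2\<close> are its two complex components.\<close>
  have "quat_pair ?T0 ?T1 * sol_b c (m, n) = of_real ?C * sol_a c (m, n)"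
    unfolding sol_a_def sol_b_def case_prod_conv of_real_quat \<alpha>\<beta>
    unfolding C_eq T0_eq T1_eq quat_pair_arith quat_pair_eq_iff
    using id1[OF Lb, of "cnj (e m)" \<i> "of_real (scale n)" "of_real (g n)" "of_real (h n)" "cnj b"
        "of_real s" a "cnj a"]
      id2[OF Lb, of \<i> "of_real (scale n)" "of_real (g n)" "of_real (h n)" "cnj b"
        "of_real s" a "cnj a"] e_nonzero[of m]
    by (simp add: ee mult_ac)
  then have "of_real (1 / ?C) * (quat_pair ?T0 ?T1 * sol_b c (m, n))
      = (of_real (1 / ?C) * of_real ?C) * sol_a c (m, n)"
    by (simp only: mult.assoc)
  moreover have "of_real (1 / ?C) * of_real ?C = (1 :: quat)"
    unfolding of_real_mult[symmetric] using C by simp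
  ultimately have "sol_a c (m, n) = of_real (1 / ?C) * (quat_pair ?T0 ?T1 * sol_b c (m, n))"
    by simp
  then show "sol_a c (m, n) * inverse (sol_b c (m, n)) = of_real (1 / ?C) * quat_pair ?T0 ?T1"
    using sol_b_nonzero[OF assms] by (simp add: mult.assoc)
qed

section \<open>Periodicity in the horizontal direction\<close>

lemma periodic:
  shows "\<exists>\<sigma>. cmod \<sigma> = 1 \<and> A c (m + int (\<rho> * M)) = \<sigma> * A c m \<and> B c (m + int (\<rho> * M)) = \<sigma> * B c m"
proof (intro exI conjI)
  have "\<theta> * of_int (m + int (\<rho> * M)) = \<theta> * m + \<kappa> * pi"
    using M \<rho> by (simp add: \<theta>_def theta_def field_simps)
  then have 1: "cis (\<theta> * of_int (m + int (\<rho> * M))) = cis (\<kappa> * pi) * cis (\<theta> * m)"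
    by (simp add: cis_mult add.commute)
  \<comment> \<open>The factor \<open>cis (\<kappa> * pi)\<close> is its own inverse, so both
    exponentials acquire the same one.\<close>
  have "cis (2 * pi * of_int \<kappa>) = 1" by simp
  then have "cis (\<kappa> * pi) * cis (\<kappa> * pi) = 1" by (simp add: cis_mult mult_ac)
  then have "cis (- (\<kappa> * pi)) = cis (\<kappa> * pi)"
    by (metis cis_inverse inverse_unique)
  moreover have "cis (- \<theta> * of_int (m + int (\<rho> * M))) = inverse (cis (\<theta> * of_int (m + int (\<rho> * M))))"
    by (simp add: cis_inverse)
  ultimately have 2: "cis (- \<theta> * of_int (m + int (\<rho> * M))) = cis (\<kappa> * pi) * cis (- \<theta> * m)"
    unfolding 1 by (simp add: cis_inverse flip: cis_inverse)
  show "A c (m + int (\<rho> * M)) = cis (\<kappa> * pi) * A c m"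
    unfolding A_eq 1 2 by (simp add: algebra_simps)
  show "B c (m + int (\<rho> * M)) = cis (\<kappa> * pi) * B c m"
    unfolding B_eq 1 2 by (simp add: algebra_simps)
  show "cmod (cis (\<kappa> * pi)) = 1" by simp
qed

lemma e_periodic: "e (m + int (\<rho> * M)) = e m"
proof -
  have "2 * pi / M * of_int (m + int (\<rho> * M)) = 2 * pi / M * m + 2 * pi * \<rho>"
    using M by (simp add: field_simps)
  then show ?thesis by (simp add: e_def flip: cis_mult)
qed

lemma cylinder_periodic: "cylinder M N (m + int (\<rho> * M), n) = cylinder M N (m, n)"
  using e_periodic[of m] unfolding cylinder_eq e_def by simp

text \<open>\<open>A\<close> and \<open>B\<close> enter only through their moduli and through
  \<open>A * cnj B\<close>, which a common factor of modulus 1 does not change.\<close>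

lemma closed_form_periodic:
  "C_fun M N \<rho> \<kappa> c (m + int (\<rho> * M), n) = C_fun M N \<rho> \<kappa> c (m, n)"
  "T0_fun M N \<rho> \<kappa> c (m + int (\<rho> * M), n) = T0_fun M N \<rho> \<kappa> c (m, n)"
  "T1_fun M N \<rho> \<kappa> c (m + int (\<rho> * M), n) = T1_fun M N \<rho> \<kappa> c (m, n)"
proof -
  obtain \<sigma> where \<sigma>: "cmod \<sigma> = 1" "A c (m + int (\<rho> * M)) = \<sigma> * A c m"
    "B c (m + int (\<rho> * M)) = \<sigma> * B c m"
    using periodic by blast
  have "\<sigma> * cnj \<sigma> = 1" using \<sigma>(1) by (simp flip: complex_norm_square)
  then have "\<sigma> * A c m * cnj (\<sigma> * B c m) = A c m * cnj (B c m)"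
    by simp
  then show "C_fun M N \<rho> \<kappa> c (m + int (\<rho> * M), n) = C_fun M N \<rho> \<kappa> c (m, n)"
    "T0_fun M N \<rho> \<kappa> c (m + int (\<rho> * M), n) = T0_fun M N \<rho> \<kappa> c (m, n)"
    "T1_fun M N \<rho> \<kappa> c (m + int (\<rho> * M), n) = T1_fun M N \<rho> \<kappa> c (m, n)"
    unfolding C_fun_eq T0_fun_eq T1_fun_eq \<sigma>(2,3) norm_mult \<sigma>(1) e_periodic mult.assoc by simp_all
qed

end

section \<open>A Darboux transform with prescribed value at the origin\<close>

locale spectral_darboux = spectral_cylinder +
  fixes fh :: "vertex \<Rightarrow> quat" and c :: complex and t :: complex
  assumes dt: "darboux_transform (cylinder M N) (cylinder_mu M N) (spectral_parameter M \<rho> \<kappa>) fh"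
    and origin: "fh (0, 0) - cylinder M N (0, 0) = quat_pair 0 t"
    and c: "D * A c 0 = - t * B c 0" and B0: "B c 0 \<noteq> 0"
begin

definition T :: "vertex \<Rightarrow> quat" where "T v = fh v - cylinder M N v"

lemma T_nonzero: "T (m, n) \<noteq> 0"
  and cr_horizontal: "cross_ratio (cylinder M N (m, n)) (cylinder M N (m + 1, n))
    (fh (m + 1, n)) (fh (m, n)) = of_real r"
proof -
  have "edge (m, n) (m + 1, n)" by (simp add: edge_def)
  then show cr: "cross_ratio (cylinder M N (m, n)) (cylinder M N (m + 1, n))
    (fh (m + 1, n)) (fh (m, n)) = of_real r"
    using dt ratio_horizontal[of m n] unfolding darboux_transform_def by metis
  have "r \<noteq> 0" using r_neg by simp
  then show "T (m, n) \<noteq> 0" using darboux_edge(3)[OF cr] by (simp add: T_def)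
qed

lemma cr_vertical: "cross_ratio (cylinder M N (m, n)) (cylinder M N (m, n + 1))
    (fh (m, n + 1)) (fh (m, n)) = of_real (s\<^sup>2 / (of_int N)\<^sup>2)"
proof -
  have "edge (m, n) (m, n + 1)" by (simp add: edge_def)
  then show ?thesis
    using dt ratio_vertical[of m n] unfolding darboux_transform_def by metis
qed

text \<open>The relation \<open>a = T b\<close> spreads from the origin in both directions.
  Non-vanishing of \<beta> is carried along: a zero of \<beta> would make \<alpha> vanish too, and
  the horizontal step would carry this zero back to the previous vertex.\<close>

lemma row0: "sol_a c (m, 0) = T (m, 0) * sol_b c (m, 0) \<and> \<beta> c m \<noteq> 0"
proof (induction m rule: int_induct[where k = 0])
  case base
  have "e 0 = 1" by (simp add: e_def)
  \<comment> \<open>Hypothesis \<open>c\<close> is exactly this case: at the origin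
    \<open>a = quat_J * A c 0\<close>, \<open>b = - B c 0 / D\<close> and
    \<open>T = quat_J * t\<close>.\<close>
  then show ?case
    using c B0 D_nonzero origin
    by (simp add: T_def sol_a_def sol_b_def gh_0 \<alpha>_def \<beta>_def field_simps)
next
  case (step1 m)
  have "sol_a c (m + 1, 0) = T (m + 1, 0) * sol_b c (m + 1, 0)"
    unfolding T_def using riccati_forward[OF cr_horizontal[of m 0] _ riccati_horizontal[of c m 0]] step1 r_neg
    by (simp add: T_def)
  moreover have "\<beta> c (m + 1) \<noteq> 0"
  proof
    assume 0: "\<beta> c (m + 1) = 0"
    then have "sol_a c (m + 1, 0) = 0"
      using calculation by (simp add: sol_b_def gh_0)
    then have "\<alpha> c (m + 1) = 0" by (simp add: sol_a_def gh_0)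
    then have "\<alpha> c m = - (e m - e (m + 1)) * \<beta> c m"
      unfolding \<alpha>_step by algebra
    moreover have "of_real r * (- x * y) / x = - of_real r * y" if "x \<noteq> 0" for x y :: complex
      using that by simp
    ultimately have "of_real r * \<alpha> c m / (e m - e (m + 1)) = - of_real r * \<beta> c m"
      using e_diff_nonzero[of m] by (simp only: not_False_eq_True)
    \<comment> \<open>With \<open>\<alpha> c (m + 1) = 0\<close> the step for \<beta> multiplies
      \<open>\<beta> c m\<close> by \<open>1 - r\<close>, which is positive.\<close>
    then have "(1 - of_real r) * \<beta> c m = 0"
      using 0 unfolding \<beta>_step by (simp add: algebra_simps)
    then have "of_real (1 - r) = (0::complex)" using step1 by simp
    then show False using r_neg by (simp only: of_real_eq_0_iff)
  qed
  ultimately show ?case ..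
next
  case (step2 m)
  have mm: "sol_a c (m, 0) = T (m, 0) * sol_b c (m, 0)" "\<beta> c m \<noteq> 0" using step2 by auto
  have 1: "sol_a c (m - 1, 0) = T (m - 1, 0) * sol_b c (m - 1, 0)"
    unfolding T_def
    using riccati_backward[OF cr_horizontal[of "m - 1" 0] _ _ riccati_horizontal[of c "m - 1" 0]] mm r_neg
    by (simp add: T_def)
  moreover have "\<beta> c (m - 1) \<noteq> 0"
  proof
    assume 0: "\<beta> c (m - 1) = 0"
    then have "sol_a c (m - 1, 0) = 0"
      using 1 by (simp add: sol_b_def gh_0)
    then have "\<alpha> c (m - 1) = 0" by (simp add: sol_a_def gh_0)
    then show False using 0 \<beta>_step[of c "m - 1"] mm by simp
  qed
  ultimately show ?case ..
qed

lemma \<alpha>_nonzero: "\<alpha> c m \<noteq> 0"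
proof
  assume "\<alpha> c m = 0"
  then have "T (m, 0) = 0"
    using row0[of m] by (auto simp: sol_a_def sol_b_def gh_0 simp flip: zero_quat_pair)
  then show False using T_nonzero by simp
qed

lemma \<beta>_nonzero: "\<beta> c m \<noteq> 0"
  using row0 by blast

lemma sol_eq:
  assumes "regular n"
  shows "sol_a c (m, n) = T (m, n) * sol_b c (m, n)"
  using assms
proof (induction n rule: int_induct[where k = 0])
  case base
  then show ?case using row0 by blast
next
  case (step1 n)
  then show ?case
    unfolding T_def
    using riccati_forward[OF cr_vertical[of m n] _ riccati_vertical[of n c m]] s_pos N
    by (simp add: T_def)
next
  case (step2 n)
  \<comment> \<open>A regular row below 0 exists only for \<open>N^2 \<noteq> s^2\<close>; then the
    vertical ratio differs from 1 and the backward step applies.\<close>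
  then have reg: "regular n" "regular (n - 1)" "(of_int N)\<^sup>2 \<noteq> s\<^sup>2" by auto
  then have "s\<^sup>2 / (of_int N)\<^sup>2 \<noteq> 1" using N by simp
  then show ?case
    unfolding T_def
    using riccati_backward[OF cr_vertical[of m "n - 1"] _ _ riccati_vertical[of "n - 1" c m]] step2 reg s_pos N
    by (simp add: T_def)
qed

lemma darboux_eq:
  assumes "regular n"
  shows "fh (m, n) = cylinder M N (m, n) + sol_a c (m, n) * inverse (sol_b c (m, n))"
  using sol_eq[OF assms, of m] sol_b_nonzero[OF assms \<alpha>_nonzero \<beta>_nonzero, of m]
  by (simp add: T_def mult.assoc)

lemma darboux_closed_form:
  assumes "regular n"
  shows "fh (m, n) = cylinder M N (m, n) + of_real (1 / C_fun M N \<rho> \<kappa> c (m, n))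
      * quat_pair (T0_fun M N \<rho> \<kappa> c (m, n)) (T1_fun M N \<rho> \<kappa> c (m, n))"
  by (simp only: darboux_eq[OF assms] closed_form(2)[OF assms \<alpha>_nonzero \<beta>_nonzero])

text \<open>For \<open>N\<^sup>2 = - \<nu>\<close> the edge relation no longer determines \<open>T (m, n)\<close> from \<open>T (m, n + 1)\<close>
  when \<open>T (m, n + 1) = d\<close>; the assumption that the initial circle is planar excludes this value.\<close>

lemma T_irregular:
  assumes "\<not> regular n" and plane: "\<And>m. \<exists>z. T (m, 0) = quat_pair 0 z"
  shows "T (m, n) = quat_pair (\<i> / of_int N) 0"
proof -
  have N2: "(of_int N)\<^sup>2 = s\<^sup>2" and "n \<le> - 1" using assms by auto
  have ratio: "s\<^sup>2 / (of_int N)\<^sup>2 = 1" unfolding N2[symmetric] using N by simp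
  define d where "d = quat_pair (- \<i> / of_int N) 0"
  have dn: "d \<noteq> 0" using N by (simp add: d_def)
  have d: "cylinder M N (m, n) - cylinder M N (m, n + 1) = d" for n
    by (simp only: cylinder_vertical d_def)
  have edge: "T (m, n + 1) = d \<or> T (m, n) = - d" for n
  proof -
    have "(inverse d * T (m, n + 1) - 1) * (inverse d * T (m, n) + 1) = 0"
      using darboux_edge_product[OF cr_vertical[of m n, unfolded ratio]] by (simp add: T_def d)
    then have "d * (inverse d * T (m, n + 1) - 1) = 0 \<or> d * (inverse d * T (m, n) + 1) = 0"
      by auto
    then show ?thesis
      using dn by (auto simp: right_diff_distrib distrib_left mult.assoc[symmetric] eq_neg_iff_add_eq_0)
  qed
  have "T (m, n) = - d"
    using \<open>n \<le> - 1\<close>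
  proof (induction n rule: int_le_induct)
    case base
    \<comment> \<open>By planarity \<open>T (m, 0)\<close> has no complex part, whereas
      \<open>d\<close> is a nonzero multiple of \<i>.\<close>
    have "T (m, 0) \<noteq> d" using plane[of m] N by (auto simp: d_def)
    then show ?case using edge[of "- 1"] by simp
  next
    case (step n)
    then have "T (m, n) \<noteq> d" using N by (simp add: d_def)
    then show ?case using edge[of "n - 1"] by simp
  qed
  then show ?thesis by (simp add: d_def)
qed

lemma darboux_periodic:
  assumes plane: "\<And>m. \<exists>z. T (m, 0) = quat_pair 0 z"
  shows "fh (m + int (\<rho> * M), n) = fh (m, n)"
proof (cases "regular n")
  case True
  then show ?thesis
    by (simp only: darboux_closed_form closed_form_periodic cylinder_periodic)
next
  case False
  then have "T (m + int (\<rho> * M), n) = T (m, n)"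
    using T_irregular[OF False plane] by simp
  then show ?thesis using cylinder_periodic[of m n] by (simp add: T_def)
qed

end

section \<open>Choice of the normalised constants\<close>

lemma (in spectral_cylinder) normalised_constant_exists:
  fixes t :: complex
  shows "(\<exists>c. D * A c 0 = - t * B c 0 \<and> B c 0 \<noteq> 0) \<or>
    (of_real D = - t * of_real (sin (p - \<theta>)) \<and> sin (p - \<theta>) \<noteq> 0)"
proof (cases "of_real D = - t * of_real (sin (p - \<theta>))")
  case True
  then show ?thesis using D_nonzero by auto
next
  case False
  define u where "u = of_real D + t * of_real (sin (p - \<theta>))"
  \<comment> \<open>The initial condition is linear in the constant, with coefficient
    \<open>u\<close>; this is its solution. The excluded case \<open>u = 0\<close> is the one where
    only the second eigenfunction occurs.\<close>
  define c where "c = - (of_real D + t * of_real (sin (p + \<theta>))) / u"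
  have u: "u \<noteq> 0" using False by (simp add: u_def eq_neg_iff_add_eq_0)
  have cu: "c * u = - (of_real D + t * of_real (sin (p + \<theta>)))"
    using u by (simp add: c_def)
  have A0: "A c 0 = 1 + c" and B0: "B c 0 = of_real (sin (p + \<theta>)) + of_real (sin (p - \<theta>)) * c"
    by (simp_all add: A_eq B_eq)
  \<comment> \<open>Eliminating \<open>c * u\<close> cancels the terms in \<open>t\<close>, so
    \<open>B c 0\<close> is nonzero for every \<open>t\<close>.\<close>
  have "B c 0 * u = of_real (D * (sin (p + \<theta>) - sin (p - \<theta>)))"
    unfolding B0 using cu by (simp add: u_def) algebra
  also have "sin (p + \<theta>) - sin (p - \<theta>) = 2 * cos p * sin \<theta>"
    by (simp add: sin_add sin_diff)
  finally have "B c 0 \<noteq> 0" using D_nonzero trig_p trig_theta by auto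
  moreover have "D * A c 0 = - t * B c 0"
    unfolding A0 B0 using cu unfolding u_def by algebra
  ultimately show ?thesis by blast
qed

lemma spectral_parameter_minus: "spectral_parameter M \<rho> (- \<kappa>) = spectral_parameter M \<rho> \<kappa>"
  by (simp add: spectral_parameter_def theta_def)

lemma exists_spectral_darboux:
  assumes "spectral_cylinder M \<rho> N \<kappa>"
    and dt: "darboux_transform (cylinder M N) (cylinder_mu M N) (spectral_parameter M \<rho> \<kappa>) fh"
    and origin: "fh (0, 0) - cylinder M N (0, 0) = quat_pair 0 t"
  obtains \<kappa>' c where "\<kappa>' = \<kappa> \<or> \<kappa>' = - \<kappa> \<and> c = 0" "spectral_darboux M \<rho> N \<kappa>' fh c t"
proof -
  interpret spectral_cylinder M \<rho> N \<kappa> by fact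
  from normalised_constant_exists[of t] show thesis
  proof
    assume "\<exists>c. D * A c 0 = - t * B c 0 \<and> B c 0 \<noteq> 0"
    then obtain c where "D * A c 0 = - t * B c 0" "B c 0 \<noteq> 0" by blast
    with dt origin have "spectral_darboux M \<rho> N \<kappa> fh c t"
      by unfold_locales
    then show thesis using that by blast
  next
    \<comment> \<open>here \<open>c\<^sup>+ = 0\<close>, so the roles of the two eigenfunctions are exchanged\<close>
    assume S: "of_real D = - t * of_real (sin (p - \<theta>)) \<and> sin (p - \<theta>) \<noteq> 0"
    interpret neg: spectral_cylinder M \<rho> N "- \<kappa>"
      using M N \<rho> spectral_neg by unfold_locales (simp_all add: spectral_parameter_minus)
    \<comment> \<open>The sign change fixes \<open>D\<close>, and at \<open>c = 0\<close> it gives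
      \<open>neg.A 0 0 = 1\<close> and \<open>neg.B 0 0 = sin (p - \<theta>)\<close>, so
      \<open>S\<close> is the required initial condition.\<close>
    have \<theta>: "neg.\<theta> = - \<theta>" by (simp add: \<theta>_def neg.\<theta>_def theta_def)
    have D: "neg.D = D" by (simp add: D_def neg.D_def \<theta>)
    have "neg.D * neg.A 0 0 = - t * neg.B 0 0" "neg.B 0 0 \<noteq> 0"
      using S by (simp_all add: neg.A_eq neg.B_eq \<theta> D)
    with dt origin have "spectral_darboux M \<rho> N (- \<kappa>) fh 0 t"
      by unfold_locales (simp_all add: spectral_parameter_minus)
    then show thesis using that by blast
  qed
qed

theorem mainTheorem6:
  fixes M \<rho> k :: nat and N :: int and \<nu> :: real
    and f fh :: "vertex \<Rightarrow> quat" and \<mu> :: "vertex \<Rightarrow> vertex \<Rightarrow> real"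
  assumes "M > 2" and "N \<noteq> 0" and "\<rho> > 0" and "k > 0"
    and "f = cylinder M N" and "\<mu> = cylinder_mu M N"
    and "\<nu> = spectral_parameter M \<rho> (int k)" and "\<nu> < 0"
    and "darboux_transform f \<mu> \<nu> fh"
    and "\<forall>m. fh (m, 0) \<in> span {quat_J, quat_K}"
  shows "discrete_isothermic f \<mu> \<and>
    discrete_isothermic fh \<mu> \<and>
    (\<forall>m n. fh (m + int (\<rho> * M), n) = fh (m, n)) \<and>
    (\<exists>\<kappa> c2 a b.
      (\<kappa> = int k \<or> \<kappa> = - int k \<and> c2 = 0) \<and>
      linearised_riccati_on (regular_vertices N \<nu>) f \<mu> \<nu> a b \<and>
      (\<forall>v\<in>regular_vertices N \<nu>. b v \<noteq> 0 \<and> fh v = f v + a v * inverse (b v)) \<and>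
      (\<forall>m. a (m, 0) = initial_a M \<rho> \<kappa> quat_J (quat_J * quat_of_complex c2) m) \<and>
      (\<forall>v\<in>regular_vertices N \<nu>.
         C_fun M N \<rho> \<kappa> c2 v \<noteq> 0 \<and>
         fh v = f v + of_real (1 / C_fun M N \<rho> \<kappa> c2 v)
           * (quat_of_complex (T0_fun M N \<rho> \<kappa> c2 v)
              + quat_J * quat_of_complex (T1_fun M N \<rho> \<kappa> c2 v))))"
proof -
  \<comment> \<open>Planarity enters twice: at the origin to determine the constant, and along the
    whole row to control the rows below 0 when \<open>N^2 = - \<nu>\<close>.\<close>
  have plane: "\<exists>z. fh (m, 0) - cylinder M N (m, 0) = quat_pair 0 z" for m
  proof -
    obtain z where "fh (m, 0) = quat_pair 0 z"
      using assms(10) span_J_K_E by blast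
    then show ?thesis by (simp add: cylinder_eq)
  qed
  obtain t where t: "fh (0, 0) - cylinder M N (0, 0) = quat_pair 0 t"
    using plane by blast
  have "spectral_cylinder M \<rho> N (int k)"
    using assms by unfold_locales simp_all
  moreover have "darboux_transform (cylinder M N) (cylinder_mu M N) (spectral_parameter M \<rho> (int k)) fh"
    using assms by simp
  ultimately obtain \<kappa> c where \<kappa>: "\<kappa> = int k \<or> \<kappa> = - int k \<and> c = 0"
    and "spectral_darboux M \<rho> N \<kappa> fh c t"
    using t by (rule exists_spectral_darboux)
  then interpret spectral_darboux M \<rho> N \<kappa> fh c t by simp
  have \<nu>: "\<nu> = spectral_parameter M \<rho> \<kappa>"
    using \<kappa> assms(7) by (auto simp: spectral_parameter_minus)
  have reg: "regular n" if "(m, n) \<in> regular_vertices N \<nu>" for m n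
    using that by (auto simp: regular_vertices_def \<nu> s_squared)
  have iso: "discrete_isothermic f \<mu>"
    using discrete_isothermic_cylinder assms by simp
  have iso_fh: "discrete_isothermic fh \<mu>"
  proof (rule discrete_isothermic_darboux_transform[OF iso assms(9)])
    show "\<mu> v w \<noteq> 0" if "edge v w" for v w
      using norm_squared_step trig_p N by (auto simp: assms(6) cylinder_mu_def p_def)
    show "\<nu> \<noteq> 0" using assms(8) by simp
    show "f i - f j = f l - f k" if "quadrilateral i j k l" for i j k l
      using that by (auto simp: quadrilateral_def assms(5) cylinder_horizontal)
  qed
  have per: "fh (m + int (\<rho> * M), n) = fh (m, n)" for m n
    using darboux_periodic plane by (simp add: T_def)
  have ric: "linearised_riccati_on (regular_vertices N \<nu>) f \<mu> \<nu> (sol_a c) (sol_b c)"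
    unfolding assms(5,6) \<nu> by (rule linearised_riccati_sol)
  have sol: "\<forall>v\<in>regular_vertices N \<nu>. sol_b c v \<noteq> 0 \<and> fh v = f v + sol_a c v * inverse (sol_b c v)"
    using reg sol_b_nonzero[OF _ \<alpha>_nonzero \<beta>_nonzero] darboux_eq unfolding assms(5) by fast
  have closed: "\<forall>v\<in>regular_vertices N \<nu>. C_fun M N \<rho> \<kappa> c v \<noteq> 0 \<and>
         fh v = f v + of_real (1 / C_fun M N \<rho> \<kappa> c v)
           * (quat_of_complex (T0_fun M N \<rho> \<kappa> c v) + quat_J * quat_of_complex (T1_fun M N \<rho> \<kappa> c v))"
    using reg closed_form(1)[OF _ \<alpha>_nonzero \<beta>_nonzero] darboux_closed_form
    unfolding assms(5) quat_pair_def by fast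
  show ?thesis
    by (intro conjI allI exI[of _ \<kappa>] exI[of _ c] exI[of _ "sol_a c"] exI[of _ "sol_b c"])
      (fact iso iso_fh per \<kappa> ric sol sol_a_initial closed)+
qed

end
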